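(* Let $n,p$ be positive integers with $n-p-1>0$ and $p \geq 2$. Observe $Y \in \mathbb{R}^{n\times p}$ whose entries are independent with $Y_{ai} \sim \mathrm{N}(M_{ai},1)$, where $M \in \mathbb{R}^{n \times p}$ is unknown, and estimate $M$ under the Frobenius loss $\|\hat M - M\|_{\mathrm F}^2=\sum_{a,i}(\hat M_{ai}-M_{ai})^2$. Let $\pi_{\mathrm{SVS}}(M)=\det(M^\top M)^{-(n-p-1)/2}$. Then the generalized Bayes estimator of $M$ with respect to $\pi_{\mathrm{SVS}}$ is inadmissible under the Frobenius loss, i.e., there exists an estimator $\tilde M(Y)$ with $\mathrm{E}_M\|\tilde M-M\|_{\mathrm F}^2 \le \mathrm{E}_M\|\hat M_{\mathrm{SVS}}-M\|_{\mathrm F}^2$ for all $M$, with strict inequality for some $M$.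
   Context: For a nonnegative function $\pi$ on $\mathbb{R}^{n\times p}$ (an improper prior) whose marginal $m_\pi(Y)=\int p(Y\mid M)\pi(M)\,\mathrm{d}M$ is finite for every $Y$ (where $p(Y\mid M)$ is the density of $Y$), the generalized Bayes estimator is the posterior mean $\hat M_\pi(Y)=\int M\, p(Y\mid M)\pi(M)\,\mathrm dM / m_\pi(Y)$. For $\pi_{\mathrm{SVS}}$ the marginal is finite for every $Y$; $\hat M_{\mathrm{SVS}}$ denotes its generalized Bayes estimator. *)

theory Defs
  imports "HOL-Analysis.Analysis"
begin

text \<open>n x p real matrices are represented as elements of type real^'p^'n
  (rows indexed by 'n, columns by 'p); n = CARD('n), p = CARD('p).
  Lebesgue measure on matrices is lborel on this Euclidean space.\<close>

definition frob_sq :: "real^'p^'n \<Rightarrow> real" where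
  "frob_sq A = (\<Sum>a\<in>UNIV. \<Sum>i\<in>UNIV. (A $ a $ i)\<^sup>2)"

definition gauss_dens :: "real^'p^'n \<Rightarrow> real^'p^'n \<Rightarrow> real" where
  "gauss_dens M Y =
     (2 * pi) powr (- (real CARD('n) * real CARD('p)) / 2) * exp (- frob_sq (Y - M) / 2)"

definition pi_SVS :: "real^'p^'n \<Rightarrow> real" where
  "pi_SVS M = det (transpose M ** M) powr (- (real CARD('n) - real CARD('p) - 1) / 2)"

definition marginal :: "(real^'p^'n \<Rightarrow> real) \<Rightarrow> real^'p^'n \<Rightarrow> real" where
  "marginal prior Y = (\<integral>M. gauss_dens M Y * prior M \<partial>lborel)"

definition gen_bayes :: "(real^'p^'n \<Rightarrow> real) \<Rightarrow> real^'p^'n \<Rightarrow> real^'p^'n" where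
  "gen_bayes prior Y =
     (1 / marginal prior Y) *\<^sub>R (\<integral>M. (gauss_dens M Y * prior M) *\<^sub>R M \<partial>lborel)"

definition M_SVS :: "real^'p^'n \<Rightarrow> real^'p^'n" where
  "M_SVS = gen_bayes pi_SVS"

definition frob_risk :: "(real^'p^'n \<Rightarrow> real^'p^'n) \<Rightarrow> real^'p^'n \<Rightarrow> ennreal" where
  "frob_risk d M = (\<integral>\<^sup>+ Y. ennreal (frob_sq (d Y - M) * gauss_dens M Y) \<partial>lborel)"

end

theory Submission
  imports Defs "HOL-Probability.Distributions"
begin

text \<open>
  Write \<open>q = n - p - 1\<close>. Up to a constant, \<open>\<pi>\<^sub>S\<^sub>V\<^sub>S(M)\<close> is the Gaussian mixture
  \<open>\<integral> exp(-\<parallel>M X\<^sup>T\<parallel>\<^sup>2/2) dX\<close> over \<open>q \<times> p\<close> matrices \<open>X\<close>. The vector field \<open>X X\<^sup>T X\<close> has divergence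
  \<open>(p + q + 1) \<parallel>X\<parallel>\<^sup>2 = n \<parallel>X\<parallel>\<^sup>2\<close>, and integrating by parts against it shows that the prior is
  superharmonic: its mean over \<open>N(Y, s\<^sup>2 I)\<close> decreases in \<open>s\<close>. Starting the smoothing at \<open>s = 0\<close> from a
  matrix of full rank, this already gives the finiteness of the marginal.

  The prior is homogeneous of degree \<open>-k\<close> with \<open>k = p q\<close>, so the same monotonicity says that
  \<open>t\<^sup>k m(t Y)\<close> increases in \<open>t\<close>, i.e. \<open>\<langle>Y, \<nabla> log m(Y)\<rangle> \<ge> -k\<close>. By Tweedie's formula
  \<open>M\<^sub>S\<^sub>V\<^sub>S(Y) = Y + \<nabla> log m(Y)\<close>. Hence, in Stein's unbiased risk estimate, replacing \<open>M\<^sub>S\<^sub>V\<^sub>S(Y)\<close> by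
  \<open>M\<^sub>S\<^sub>V\<^sub>S(Y) - Y / (1 + \<parallel>Y\<parallel>\<^sup>2)\<close> changes the risk by at most
  \<open>-(2 (n p - k) - 5) E[1 / (1 + \<parallel>Y\<parallel>\<^sup>2)]\<close>, which is negative because \<open>n p - k = p (p + 1) \<ge> 6\<close>.
\<close>

section \<open>Integration on Euclidean spaces\<close>

lemma integral_lborel_shift:
  fixes f :: "'a::euclidean_space \<Rightarrow> real"
  assumes "f \<in> borel_measurable borel"
  shows "(\<integral>x. f (x + c) \<partial>lborel) = (\<integral>x. f x \<partial>lborel)"
    and "integrable lborel (\<lambda>x. f (x + c)) \<longleftrightarrow> integrable lborel f"
proof -
  have *: "distr lborel borel (\<lambda>x. x + c) = lborel"
    using lborel_distr_plus[of c] by (metis (no_types, lifting) add.commute ext)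
  show "(\<integral>x. f (x + c) \<partial>lborel) = (\<integral>x. f x \<partial>lborel)"
    by (subst (2) *[symmetric], subst integral_distr) (use assms in simp_all)
  show "integrable lborel (\<lambda>x. f (x + c)) \<longleftrightarrow> integrable lborel f"
    by (subst (2) *[symmetric], subst integrable_distr_eq) (use assms in simp_all)
qed

lemma integral_lborel_pos:
  fixes f :: "'a::euclidean_space \<Rightarrow> real"
  assumes int: "integrable lborel f" and pos: "AE x in lborel. 0 < f x"
  shows "0 < (\<integral>x. f x \<partial>lborel)"
proof (rule ccontr)
  have nn: "AE x in lborel. 0 \<le> f x" using pos by eventually_elim simp
  assume "\<not> ?thesis"
  then have "(\<integral>x. f x \<partial>lborel) = 0" using integral_nonneg_AE[OF nn] by simp
  then have "AE x in lborel. f x = 0" using integral_nonneg_eq_0_iff_AE[OF int nn] by simp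
  with pos have "AE x in (lborel :: 'a measure). False" by eventually_elim simp
  then have "emeasure (lborel :: 'a measure) UNIV = 0"
    by (simp add: AE_iff_measurable[OF _ refl])
  then show False by simp
qed

text \<open>The fundamental theorem of calculus in \<open>s\<close> for each fixed \<open>v\<close>,
  followed by Fubini. The bound \<open>C\<close> on the L1 norms gives integrability over the strip
  \<open>{a..b}\<close> times the space. This takes the place of differentiation under the integral
  sign.\<close>

lemma integral_FTC_parametric:
  fixes g g' :: "real \<Rightarrow> 'a::euclidean_space \<Rightarrow> real"
  assumes ab: "a \<le> b"
    and der: "\<And>s v. ((\<lambda>s. g s v) has_real_derivative g' s v) (at s)"
    and cont: "continuous_on UNIV (\<lambda>(s, v). g' s v)"
    and int: "\<And>s. integrable lborel (g' s)"
    and bnd: "\<And>s. s \<in> {a..b} \<Longrightarrow> (\<integral>v. \<bar>g' s v\<bar> \<partial>lborel) \<le> C"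
    and iga: "integrable lborel (g a)" and igb: "integrable lborel (g b)"
  shows "(\<integral>v. g b v \<partial>lborel) - (\<integral>v. g a v \<partial>lborel)
           = (\<integral>s. indicator {a..b} s * (\<integral>v. g' s v \<partial>lborel) \<partial>lborel)"
proof -
  define h where "h = (\<lambda>s v. indicator {a..b} s * g' s v)"
  have [measurable]: "(\<lambda>(s, v). g' s v) \<in> borel_measurable (borel \<Otimes>\<^sub>M borel)"
    using borel_measurable_continuous_onI[OF cont] by (simp add: borel_prod)
  have hm[measurable]: "case_prod h \<in> borel_measurable (lborel \<Otimes>\<^sub>M lborel)"
    unfolding h_def by measurable
  have "integrable (lborel \<Otimes>\<^sub>M lborel) (case_prod h)"
  proof (rule lborel_pair.Fubini_integrable)
    show "integrable lborel (\<lambda>s. \<integral>v. norm (case_prod h (s, v)) \<partial>lborel)"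
    proof (rule Bochner_Integration.integrable_bound)
      show "integrable lborel (\<lambda>s. indicator {a..b} s * C)"
        by (intro integrable_mult_left integrable_real_indicator) (use ab in auto)
      show "AE s in lborel. norm (\<integral>v. norm (case_prod h (s, v)) \<partial>lborel)
              \<le> norm (indicator {a..b} s * C)"
      proof (rule AE_I2)
        fix s
        show "norm (\<integral>v. norm (case_prod h (s, v)) \<partial>lborel) \<le> norm (indicator {a..b} s * C)"
          using bnd[of s] by (auto simp: h_def indicator_def abs_mult)
      qed
    qed measurable
    show "AE s in lborel. integrable lborel (\<lambda>v. case_prod h (s, v))"
      using int by (simp add: h_def)
  qed (rule hm)
  note F = lborel_pair.Fubini_integral[OF this]
  have "(\<integral>s. h s v \<partial>lborel) = g b v - g a v" for v
  proof -
    have c: "isCont (\<lambda>s. g' s v) s" for s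
    proof -
      have "continuous_on UNIV ((\<lambda>(s, v). g' s v) \<circ> (\<lambda>s. (s, v)))"
        by (rule continuous_on_compose) (auto intro!: continuous_intros continuous_on_subset[OF cont])
      then show ?thesis by (simp add: o_def continuous_on_eq_continuous_at)
    qed
    show ?thesis
      using integral_FTC_Icc_real[OF ab, of "\<lambda>s. g s v" "\<lambda>s. g' s v"] der c
      by (simp add: h_def mult.commute)
  qed
  with F iga igb show ?thesis
    by (simp add: h_def)
qed

text \<open>Translation invariance replaces the vanishing of boundary terms, so no decay is needed.\<close>

lemma integral_directional_derivative_eq_0:
  fixes f D :: "'a::euclidean_space \<Rightarrow> real"
  assumes der: "\<And>x. ((\<lambda>t. f (x + t *\<^sub>R b)) has_real_derivative D x) (at 0)"
    and cont: "continuous_on UNIV D"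
    and fm: "f \<in> borel_measurable borel"
    and int: "integrable lborel f" "integrable lborel D"
  shows "(\<integral>x. D x \<partial>lborel) = 0"
proof -
  have Dm: "D \<in> borel_measurable borel"
    by (rule borel_measurable_continuous_onI[OF cont])
  have der': "((\<lambda>t. f (x + t *\<^sub>R b)) has_real_derivative D (x + s *\<^sub>R b)) (at s)" for x s
  proof -
    have "((\<lambda>t. f (x + s *\<^sub>R b + (t - s) *\<^sub>R b)) has_real_derivative D (x + s *\<^sub>R b)) (at s)"
      using der[of "x + s *\<^sub>R b"] DERIV_shift[of "\<lambda>t. f (x + s *\<^sub>R b + (t - s) *\<^sub>R b)" _ 0 s] by simp
    then show ?thesis by (simp add: algebra_simps)
  qed
  \<comment> \<open>The two integrals on the left are translates of one another, and the inner
    integral on the right is the integral of \<open>D\<close> for every \<open>s\<close>. Averaging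
    over a unit interval thus returns the integral of \<open>D\<close>.\<close>
  have "(\<integral>v. f (v + 1 *\<^sub>R b) \<partial>lborel) - (\<integral>v. f (v + 0 *\<^sub>R b) \<partial>lborel)
     = (\<integral>s. indicator {0..1} s * (\<integral>v. D (v + s *\<^sub>R b) \<partial>lborel) \<partial>lborel)"
  proof (rule integral_FTC_parametric)
    show "continuous_on UNIV (\<lambda>(s, v). D (v + s *\<^sub>R b))"
      unfolding split_beta
      by (rule continuous_on_compose2[OF cont]) (auto intro!: continuous_intros)
    show "(\<integral>v. \<bar>D (v + s *\<^sub>R b)\<bar> \<partial>lborel) \<le> (\<integral>v. \<bar>D v\<bar> \<partial>lborel)" for s
      using integral_lborel_shift(1)[of "\<lambda>v. \<bar>D v\<bar>" "s *\<^sub>R b"] Dm by simp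
  qed (use der' int integral_lborel_shift(2)[OF fm] integral_lborel_shift(2)[OF Dm] in simp_all)
  then show ?thesis
    using integral_lborel_shift(1)[OF fm] integral_lborel_shift(1)[OF Dm] by simp
qed

section \<open>Gaussian weights and functions of polynomial growth\<close>

lemma integrable_gaussian:
  fixes c :: real
  assumes "0 < c"
  shows "integrable lborel (\<lambda>x::'a::euclidean_space. exp (- c * (norm x)\<^sup>2))"
proof (rule integrableI_nonneg)
  define \<sigma> where "\<sigma> = sqrt (1 / (2 * c))"
  have s: "0 < \<sigma>" "\<sigma>\<^sup>2 = 1 / (2 * c)" using assms by (simp_all add: \<sigma>_def)
  have "integrable lborel (\<lambda>t. sqrt (2 * pi * \<sigma>\<^sup>2) * normal_density 0 \<sigma> t)"
    by (intro integrable_mult_right integrable_normal_density s)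
  also have "(\<lambda>t. sqrt (2 * pi * \<sigma>\<^sup>2) * normal_density 0 \<sigma> t) = (\<lambda>t. exp (- c * t\<^sup>2))"
    using s assms by (auto simp: normal_density_def fun_eq_iff field_simps)
  finally have "integrable lborel (\<lambda>t. exp (- c * t\<^sup>2))" .
  then have fin: "(\<integral>\<^sup>+ t. ennreal (exp (- c * t\<^sup>2)) \<partial>lborel) < \<infinity>"
    by (simp add: nn_integral_eq_integral)
  have "exp (- c * (norm x)\<^sup>2) = (\<Prod>b\<in>Basis. exp (- c * (x \<bullet> b)\<^sup>2))" for x :: 'a
  proof -
    have "(norm x)\<^sup>2 = (\<Sum>b\<in>Basis. (x \<bullet> b)\<^sup>2)"
      unfolding power2_norm_eq_inner by (subst euclidean_inner) (simp add: power2_eq_square)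
    then show ?thesis by (simp add: exp_sum[symmetric] sum_distrib_left sum_negf)
  qed
  then have "(\<integral>\<^sup>+ x. ennreal (exp (- c * (norm (x::'a))\<^sup>2)) \<partial>lborel)
      = (\<Prod>b\<in>(Basis::'a set). \<integral>\<^sup>+ t. ennreal (exp (- c * t\<^sup>2)) \<partial>lborel)"
    by (subst nn_integral_lborel_prod[symmetric]) (simp_all add: prod_ennreal)
  also have "\<dots> < \<infinity>" using fin by (simp add: power_less_top_ennreal)
  finally show "(\<integral>\<^sup>+ x. ennreal (exp (- c * (norm (x::'a))\<^sup>2)) \<partial>lborel) < \<infinity>" .
qed auto

text \<open>A class closed under all operations from which the integrands below are built, so that
  integrability against a Gaussian weight reduces to applying
  \<open>poly_growth_intros\<close>.\<close>

definition poly_growth :: "('a::real_normed_vector \<Rightarrow> 'b::real_normed_vector) \<Rightarrow> bool" where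
  "poly_growth f \<longleftrightarrow> (\<exists>C k. \<forall>x. norm (f x) \<le> C * (1 + norm x) ^ k)"

lemma poly_growthI: "(\<And>x. norm (f x) \<le> C * (1 + norm x) ^ k) \<Longrightarrow> poly_growth f"
  unfolding poly_growth_def by blast

lemma poly_growthE:
  assumes "poly_growth f"
  obtains C k where "0 \<le> C" "\<And>x. norm (f x) \<le> C * (1 + norm x) ^ k"
proof -
  obtain C k where *: "\<And>x. norm (f x) \<le> C * (1 + norm x) ^ k"
    using assms unfolding poly_growth_def by blast
  have "0 \<le> C" using order_trans[OF norm_ge_zero *[of 0]] by simp
  with * that show thesis by blast
qed

lemma poly_growth_mono:
  assumes "poly_growth g" "\<And>x. norm (f x) \<le> norm (g x)"
  shows "poly_growth f"
  using assms order_trans unfolding poly_growth_def by metis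

lemma poly_growth_const: "poly_growth (\<lambda>x. c)"
  by (rule poly_growthI[where C = "norm c" and k = 0]) simp

lemma poly_growth_id: "poly_growth (\<lambda>x. x)"
  by (rule poly_growthI[where C = 1 and k = 1]) simp

lemma poly_growth_add:
  assumes "poly_growth f" "poly_growth g"
  shows "poly_growth (\<lambda>x. f x + g x)"
proof -
  obtain C k where f: "0 \<le> C" "\<And>x. norm (f x) \<le> C * (1 + norm x) ^ k"
    using poly_growthE[OF assms(1)] by blast
  obtain D l where g: "0 \<le> D" "\<And>x. norm (g x) \<le> D * (1 + norm x) ^ l"
    using poly_growthE[OF assms(2)] by blast
  show ?thesis
  proof (rule poly_growthI[where C = "C + D" and k = "k + l"])
    fix x :: 'a
    have "norm (f x + g x) \<le> C * (1 + norm x) ^ k + D * (1 + norm x) ^ l"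
      by (rule norm_triangle_le) (use f(2) g(2) in \<open>auto intro: add_mono\<close>)
    also have "\<dots> \<le> C * (1 + norm x) ^ (k + l) + D * (1 + norm x) ^ (k + l)"
      using f(1) g(1) by (intro add_mono mult_left_mono power_increasing) auto
    finally show "norm (f x + g x) \<le> (C + D) * (1 + norm x) ^ (k + l)"
      by (simp add: algebra_simps)
  qed
qed

lemma poly_growth_prod_bound:
  assumes "poly_growth f" "poly_growth g" "\<And>x. norm (h x) \<le> norm (f x) * norm (g x)"
  shows "poly_growth h"
proof -
  obtain C k where f: "0 \<le> C" "\<And>x. norm (f x) \<le> C * (1 + norm x) ^ k"
    using poly_growthE[OF assms(1)] by blast
  obtain D l where g: "0 \<le> D" "\<And>x. norm (g x) \<le> D * (1 + norm x) ^ l"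
    using poly_growthE[OF assms(2)] by blast
  show ?thesis
  proof (rule poly_growthI[where C = "C * D" and k = "k + l"])
    fix x :: 'a
    have "norm (h x) \<le> (C * (1 + norm x) ^ k) * (D * (1 + norm x) ^ l)"
      by (rule order_trans[OF assms(3)], rule mult_mono) (use f g in auto)
    then show "norm (h x) \<le> C * D * (1 + norm x) ^ (k + l)"
      by (simp add: power_add algebra_simps)
  qed
qed

lemma poly_growth_mult:
  fixes f g :: "'a::real_normed_vector \<Rightarrow> real"
  shows "poly_growth f \<Longrightarrow> poly_growth g \<Longrightarrow> poly_growth (\<lambda>x. f x * g x)"
  by (erule (1) poly_growth_prod_bound) (simp add: abs_mult)

lemma poly_growth_scaleR:
  "poly_growth f \<Longrightarrow> poly_growth g \<Longrightarrow> poly_growth (\<lambda>x. f x *\<^sub>R g x)"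
  by (erule (1) poly_growth_prod_bound) simp

lemma poly_growth_inner:
  "poly_growth f \<Longrightarrow> poly_growth g \<Longrightarrow> poly_growth (\<lambda>x. f x \<bullet> g x)"
  by (erule (1) poly_growth_prod_bound) (simp add: Cauchy_Schwarz_ineq2)

lemma poly_growth_uminus: "poly_growth f \<Longrightarrow> poly_growth (\<lambda>x. - f x)"
  by (erule poly_growth_mono) simp

lemma poly_growth_diff: "poly_growth f \<Longrightarrow> poly_growth g \<Longrightarrow> poly_growth (\<lambda>x. f x - g x)"
  using poly_growth_add[of f "\<lambda>x. - g x"] poly_growth_uminus[of g] by simp

lemma poly_growth_fst: "poly_growth f \<Longrightarrow> poly_growth (\<lambda>x. fst (f x))"
  by (erule poly_growth_mono) (rule norm_fst_le[of "fst y" "snd y" for y, simplified])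

lemma poly_growth_snd: "poly_growth f \<Longrightarrow> poly_growth (\<lambda>x. snd (f x))"
  by (erule poly_growth_mono) (rule norm_snd_le[of "snd y" "fst y" for y, simplified])

lemma poly_growth_vec_nth: "poly_growth f \<Longrightarrow> poly_growth (\<lambda>x. f x $ i)"
  by (erule poly_growth_mono) (rule Finite_Cartesian_Product.norm_nth_le)

lemma poly_growth_sum: "(\<And>i. i \<in> A \<Longrightarrow> poly_growth (f i)) \<Longrightarrow> poly_growth (\<lambda>x. \<Sum>i\<in>A. f i x)"
  by (induction A rule: infinite_finite_induct) (auto intro: poly_growth_const poly_growth_add)

lemma poly_growth_vec_lambda: "(\<And>i. poly_growth (f i)) \<Longrightarrow> poly_growth (\<lambda>x. \<chi> i. f i x)"
proof (rule poly_growth_mono)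
  assume *: "\<And>i. poly_growth (f i)"
  have "poly_growth (\<lambda>x. norm (f i x))" for i
    by (rule poly_growth_mono[OF *[of i]]) simp
  then show "poly_growth (\<lambda>x. \<Sum>i\<in>UNIV. norm (f i x))"
    by (intro poly_growth_sum)
  show "norm (\<chi> i. f i x) \<le> norm (\<Sum>i\<in>UNIV. norm (f i x))" for x
    using L2_set_le_sum[of UNIV "\<lambda>i. norm (f i x)"] by (simp add: norm_vec_def sum_nonneg)
qed

lemma poly_growth_abs: "poly_growth f \<Longrightarrow> poly_growth (\<lambda>x. \<bar>f x\<bar>::real)"
  by (erule poly_growth_mono) simp

lemmas poly_growth_intros = poly_growth_vec_lambda poly_growth_abs poly_growth_const poly_growth_id poly_growth_add poly_growth_mult
  poly_growth_scaleR poly_growth_inner poly_growth_uminus poly_growth_diff poly_growth_fst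
  poly_growth_snd poly_growth_vec_nth poly_growth_sum

text \<open>Half of the Gaussian absorbs the polynomial: \<open>(1 + r) ^ k\<close> is at most
  \<open>exp (k * r)\<close>, and completing the square bounds \<open>k * r\<close> by
  \<open>k\<^sup>2 / (2 * c) + c / 2 * r\<^sup>2\<close>. A Gaussian with rate \<open>c / 2\<close>
  remains.\<close>

lemma integrable_poly_growth_gaussian:
  fixes f :: "'a::euclidean_space \<Rightarrow> real"
  assumes pg: "poly_growth f" and fm: "(\<lambda>x. f x * w x) \<in> borel_measurable borel"
    and c: "0 < c" and w: "\<And>x. \<bar>w x\<bar> \<le> K * exp (- c * (norm x)\<^sup>2)"
  shows "integrable lborel (\<lambda>x. f x * w x)"
proof -
  obtain C k where f: "0 \<le> C" "\<And>x. norm (f x) \<le> C * (1 + norm x) ^ k"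
    using poly_growthE[OF pg] by blast
  have K: "0 \<le> K" using w[of 0] abs_ge_zero[of "w 0"] by simp
  have "(1 + r) ^ k * exp (- c * r\<^sup>2) \<le> exp ((real k)\<^sup>2 / (2 * c)) * exp (- (c / 2) * r\<^sup>2)"
    if "0 \<le> r" for r :: real
  proof -
    have "real k * r \<le> (real k)\<^sup>2 / (2 * c) + c / 2 * r\<^sup>2"
    proof -
      have "0 \<le> (real k - c * r)\<^sup>2 / (2 * c)" using c by simp
      then show ?thesis using c by (simp add: power2_eq_square field_simps)
    qed
    then have "exp (real k * r - c * r\<^sup>2) \<le> exp ((real k)\<^sup>2 / (2 * c) - c / 2 * r\<^sup>2)"
      by simp
    moreover have "(1 + r) ^ k \<le> exp (real k * r)"
      using power_mono[of "1 + r" "exp r" k] that exp_ge_add_one_self[of r]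
      by (simp add: exp_of_nat_mult)
    ultimately have "(1 + r) ^ k * exp (- c * r\<^sup>2) \<le> exp (real k * r) * exp (- c * r\<^sup>2)"
      by simp
    also have "\<dots> = exp (real k * r - c * r\<^sup>2)"
      by (simp flip: exp_add)
    also have "\<dots> \<le> exp ((real k)\<^sup>2 / (2 * c) - c / 2 * r\<^sup>2)" by fact
    also have "\<dots> = exp ((real k)\<^sup>2 / (2 * c)) * exp (- (c / 2) * r\<^sup>2)"
      by (simp flip: exp_add)
    finally show ?thesis .
  qed note bnd = this
  show ?thesis
  proof (rule Bochner_Integration.integrable_bound)
    show "integrable lborel (\<lambda>x::'a. C * K * exp ((real k)\<^sup>2 / (2 * c)) * exp (- (c / 2) * (norm x)\<^sup>2))"
      by (intro integrable_mult_right integrable_gaussian) (use c in simp)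
    show "AE x in lborel. norm (f x * w x) \<le> norm (C * K * exp ((real k)\<^sup>2 / (2 * c)) * exp (- (c / 2) * (norm x)\<^sup>2))"
    proof (rule AE_I2)
      fix x :: 'a
      have "norm (f x * w x) \<le> (C * (1 + norm x) ^ k) * (K * exp (- c * (norm x)\<^sup>2))"
        unfolding norm_mult by (rule mult_mono) (use f w[of x] in auto)
      also have "\<dots> = C * K * ((1 + norm x) ^ k * exp (- c * (norm x)\<^sup>2))" by simp
      also have "\<dots> \<le> C * K * (exp ((real k)\<^sup>2 / (2 * c)) * exp (- (c / 2) * (norm x)\<^sup>2))"
        by (rule mult_left_mono[OF bnd]) (use f K in auto)
      finally show "norm (f x * w x) \<le> norm (C * K * exp ((real k)\<^sup>2 / (2 * c)) * exp (- (c / 2) * (norm x)\<^sup>2))"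
        using f K by (simp add: abs_mult mult.assoc)
    qed
  qed (use fm in simp)
qed

section \<open>Matrices as families of rows\<close>

lemma bij_betw_Basis_matrix:
  "bij_betw (\<lambda>x. axis (fst x) (axis (snd x) 1)) UNIV (Basis :: (real^'p^'n) set)"
  by (auto simp: bij_betw_def inj_def axis_eq_axis prod_eq_iff Basis_vec_def image_iff)

lemma sum_Basis_matrix:
  fixes h :: "real^'p^'n \<Rightarrow> 'b::comm_monoid_add"
  shows "(\<Sum>b\<in>Basis. h b) = (\<Sum>a\<in>UNIV. \<Sum>i\<in>UNIV. h (axis a (axis i 1)))"
  using sum.reindex_bij_betw[OF bij_betw_Basis_matrix, of h]
  by (simp add: sum.cartesian_product split_beta)

lemma prod_Basis_matrix:
  fixes h :: "real^'p^'n \<Rightarrow> 'b::comm_monoid_mult"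
  shows "(\<Prod>b\<in>Basis. h b) = (\<Prod>a\<in>UNIV. \<Prod>i\<in>UNIV. h (axis a (axis i 1)))"
  using prod.reindex_bij_betw[OF bij_betw_Basis_matrix, of h]
  by (simp add: prod.cartesian_product split_beta)

text \<open>In matrix notation these are \<open>A B\<^sup>T B\<close> and \<open>\<parallel>A B\<^sup>T\<parallel>\<^sub>F\<^sup>2\<close>; matrices are families of rows.\<close>

definition gram_act :: "real^'p^'m \<Rightarrow> real^'p^'k \<Rightarrow> real^'p^'m" where
  "gram_act A B = (\<chi> a. \<Sum>j\<in>UNIV. (A $ a \<bullet> B $ j) *\<^sub>R B $ j)"

definition cross_sq :: "real^'p^'m \<Rightarrow> real^'p^'k \<Rightarrow> real" where
  "cross_sq A B = (\<Sum>a\<in>UNIV. \<Sum>j\<in>UNIV. (A $ a \<bullet> B $ j)\<^sup>2)"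

lemma cross_sq_commute: "cross_sq A B = cross_sq B A"
  unfolding cross_sq_def by (subst sum.swap) (simp add: inner_commute)

lemma cross_sq_nonneg: "0 \<le> cross_sq A B"
  unfolding cross_sq_def by (intro sum_nonneg) simp

lemma gram_act_nth: "gram_act A B $ a = (\<Sum>j\<in>UNIV. (A $ a \<bullet> B $ j) *\<^sub>R B $ j)"
  by (simp add: gram_act_def)

lemma gram_act_inner: "gram_act A B \<bullet> H = (\<Sum>a\<in>UNIV. \<Sum>j\<in>UNIV. (A $ a \<bullet> B $ j) * (H $ a \<bullet> B $ j))"
  unfolding inner_vec_def[of "gram_act A B"] gram_act_nth inner_sum_left
  by (simp add: inner_commute)

lemma gram_act_inner_self: "gram_act A B \<bullet> A = cross_sq A B"
  by (simp add: gram_act_inner cross_sq_def power2_eq_square)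

lemma gram_act_add: "gram_act (A + t *\<^sub>R H) B = gram_act A B + t *\<^sub>R gram_act H B"
  by (simp add: vec_eq_iff gram_act_nth inner_add_left algebra_simps sum.distrib sum_distrib_left)

lemma DERIV_cross_sq_left:
  "((\<lambda>t. cross_sq (A + (t * s) *\<^sub>R H) B) has_real_derivative 2 * s * (gram_act A B \<bullet> H)) (at 0)"
  unfolding cross_sq_def gram_act_inner
  by (auto intro!: derivative_eq_intros sum.cong simp: sum_distrib_left inner_add_left)

lemma DERIV_cross_sq_right:
  "((\<lambda>t. cross_sq A (B + t *\<^sub>R K)) has_real_derivative 2 * (gram_act B A \<bullet> K)) (at 0)"
  using DERIV_cross_sq_left[of B 1 K A] by (simp add: cross_sq_commute[of A])

lemma DERIV_gram_act_self:
  "((\<lambda>t. gram_act (X + t *\<^sub>R K) (X + t *\<^sub>R K) \<bullet> K) has_real_derivative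
     (\<Sum>j\<in>UNIV. \<Sum>b\<in>UNIV. (X $ j \<bullet> X $ b) * (K $ j \<bullet> K $ b)
        + ((X $ j \<bullet> K $ b) + (K $ j \<bullet> X $ b)) * (K $ j \<bullet> X $ b))) (at 0)"
  unfolding gram_act_inner
  by (auto intro!: derivative_eq_intros sum.cong simp: inner_add_left inner_add_right)

section \<open>Traces and divergences over the standard basis of matrices\<close>

lemma norm_matrix_sq: "(norm (A::real^'p^'n))\<^sup>2 = (\<Sum>a\<in>UNIV. \<Sum>i\<in>UNIV. (A $ a $ i)\<^sup>2)"
  unfolding power2_norm_eq_inner by (simp add: inner_vec_def power2_eq_square)

lemma axis_nth_inner: "(axis k v :: 'a::real_inner^'n) $ j \<bullet> y = (if j = k then v \<bullet> y else 0)"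
  by (simp add: axis_def)

lemma inner_axis_nth: "y \<bullet> (axis k v :: 'a::real_inner^'n) $ j = (if j = k then y \<bullet> v else 0)"
  by (simp add: axis_def)

text \<open>The trace of right multiplication by \<open>X\<^sup>T X\<close> on matrices with n rows:
  each row contributes the trace of \<open>X\<^sup>T X\<close>, which is the squared norm of
  \<open>X\<close>.\<close>

lemma sum_gram_act_Basis:
  fixes X :: "real^'p^'q"
  shows "(\<Sum>b\<in>Basis. gram_act (b::real^'p^'n) X \<bullet> b) = real CARD('n) * (norm X)\<^sup>2"
proof -
  have "gram_act (axis a (axis i 1) :: real^'p^'n) X \<bullet> axis a (axis i 1) = (\<Sum>j\<in>UNIV. (X $ j $ i)\<^sup>2)" for a i
  proof -
    have "(\<Sum>c\<in>UNIV. \<Sum>j\<in>UNIV. ((axis a (axis i 1) :: real^'p^'n) $ c \<bullet> X $ j) * (axis a (axis i 1) $ c \<bullet> X $ j))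
      = (\<Sum>c\<in>UNIV. if c = a then (\<Sum>j\<in>UNIV. (X $ j $ i)\<^sup>2) else 0)"
      by (rule sum.cong) (auto simp: axis_nth_inner inner_axis' power2_eq_square)
    then show ?thesis by (simp add: gram_act_inner)
  qed
  then show ?thesis
    unfolding sum_Basis_matrix norm_matrix_sq by (subst (2) sum.swap) simp
qed

text \<open>The divergence of the field \<open>X X\<^sup>T X\<close>, summed from
  \<open>DERIV_gram_act_self\<close>. The three terms of the product rule contribute p, 1 and q
  times the squared norm, in this order.\<close>

lemma sum_DERIV_gram_act_self_Basis:
  fixes X :: "real^'p^'q"
  shows "(\<Sum>K\<in>Basis. \<Sum>j\<in>UNIV. \<Sum>b\<in>UNIV. (X $ j \<bullet> X $ b) * (K $ j \<bullet> K $ b)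
        + ((X $ j \<bullet> K $ b) + (K $ j \<bullet> X $ b)) * (K $ j \<bullet> X $ b))
     = (real CARD('p) + real CARD('q) + 1) * (norm X)\<^sup>2"
proof -
  have "(\<Sum>j\<in>UNIV. \<Sum>b\<in>UNIV. (X $ j \<bullet> X $ b) * ((axis k (axis i 1) :: real^'p^'q) $ j \<bullet> axis k (axis i 1) $ b)
        + ((X $ j \<bullet> axis k (axis i 1) $ b) + (axis k (axis i 1) $ j \<bullet> X $ b)) * (axis k (axis i 1) $ j \<bullet> X $ b))
     = (\<Sum>i\<in>UNIV. (X $ k $ i)\<^sup>2) + (X $ k $ i)\<^sup>2 + (\<Sum>b\<in>UNIV. (X $ b $ i)\<^sup>2)" (is "?L = ?R") for k i
  proof -
    have "?L = (\<Sum>j\<in>UNIV. if j = k then (\<Sum>b\<in>UNIV.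
        (if b = k then (X $ k \<bullet> X $ k) + (X $ k $ i)\<^sup>2 else 0) + (X $ b $ i)\<^sup>2) else 0)"
      by (rule sum.cong) (auto simp: axis_nth_inner inner_axis_nth inner_axis' inner_axis
          inner_axis_axis power2_eq_square algebra_simps axis_def[of k] intro!: sum.cong)
    also have "\<dots> = ?R"
      by (simp add: sum.distrib inner_vec_def power2_eq_square)
    finally show ?thesis .
  qed
  moreover have "(\<Sum>i\<in>UNIV. \<Sum>b\<in>UNIV. (X $ b $ i)\<^sup>2) = (\<Sum>b\<in>UNIV. \<Sum>i\<in>UNIV. (X $ b $ i)\<^sup>2)"
    by (rule sum.swap)
  ultimately show ?thesis
    unfolding sum_Basis_matrix norm_matrix_sq
    by (simp add: sum.distrib algebra_simps flip: sum_distrib_left)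
qed

text \<open>By cyclicity both sides are the trace of
  \<open>X\<^sup>T X X\<^sup>T X M\<^sup>T M\<close>. This makes integration by parts in the mixing
  variable reproduce the quadratic term that arises from the noise variable.\<close>

lemma gram_act_inner_gram_act:
  "gram_act X X \<bullet> gram_act X M = gram_act M X \<bullet> gram_act M X"
proof -
  have "gram_act X X \<bullet> gram_act X M
      = (\<Sum>j\<in>UNIV. \<Sum>b\<in>UNIV. \<Sum>a\<in>UNIV. (X $ j \<bullet> X $ b) * (X $ j \<bullet> M $ a) * (M $ a \<bullet> X $ b))"
    by (simp add: gram_act_inner gram_act_nth inner_sum_left sum_distrib_left mult.assoc)
  also have "\<dots> = (\<Sum>a\<in>UNIV. \<Sum>j\<in>UNIV. \<Sum>b\<in>UNIV. (X $ j \<bullet> X $ b) * (X $ j \<bullet> M $ a) * (M $ a \<bullet> X $ b))"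
    by (rule trans[OF sum.cong[OF refl sum.swap] sum.swap])
  also have "\<dots> = gram_act M X \<bullet> gram_act M X"
    by (simp add: gram_act_inner gram_act_nth inner_sum_left inner_sum_right sum_distrib_left inner_commute ac_simps)
  finally show ?thesis .
qed

section \<open>Gaussian smoothing of the regularised mixture\<close>

lemma exp_gaussian_pair_bound:
  fixes v :: "'a::euclidean_space \<times> 'b::euclidean_space"
  assumes e: "0 < e" and q: "0 \<le> q"
  shows "\<bar>exp (- ((norm (fst v))\<^sup>2 + e * (norm (snd v))\<^sup>2 + q) / 2)\<bar>
           \<le> 1 * exp (- (min 1 e / 2) * (norm v)\<^sup>2)"
proof -
  have "min 1 e * (norm (fst v))\<^sup>2 \<le> 1 * (norm (fst v))\<^sup>2"
       "min 1 e * (norm (snd v))\<^sup>2 \<le> e * (norm (snd v))\<^sup>2"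
    by (intro mult_right_mono; simp)+
  then have "min 1 e * (norm v)\<^sup>2 \<le> (norm (fst v))\<^sup>2 + e * (norm (snd v))\<^sup>2 + q"
    using q by (simp add: norm_prod_def algebra_simps)
  then show ?thesis by simp
qed

lemma DERIV_mult_exp_half:
  fixes f h :: "real \<Rightarrow> real"
  assumes "(f has_real_derivative f') (at 0)" "(h has_real_derivative h') (at 0)"
  shows "((\<lambda>t. f t * exp (- h t / 2)) has_real_derivative (f' - f 0 * h' / 2) * exp (- h 0 / 2)) (at 0)"
  by (rule derivative_eq_intros assms refl | simp)+ (simp add: algebra_simps)

lemma DERIV_norm_sq_line:
  "((\<lambda>t. (norm (x + t *\<^sub>R b))\<^sup>2) has_real_derivative 2 * (x \<bullet> b)) (at 0)"
  unfolding power2_norm_eq_inner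
  by (auto intro!: derivative_eq_intros simp: inner_add_left inner_add_right inner_commute)

lemma poly_growth_gram_act:
  "poly_growth f \<Longrightarrow> poly_growth g \<Longrightarrow> poly_growth (\<lambda>x. gram_act (f x) (g x))"
  unfolding gram_act_def by (intro poly_growth_intros)

lemma continuous_on_gram_act:
  "continuous_on S f \<Longrightarrow> continuous_on S g \<Longrightarrow> continuous_on S (\<lambda>x. gram_act (f x) (g x))"
  unfolding gram_act_def by (intro continuous_intros)

lemma continuous_on_cross_sq:
  "continuous_on S f \<Longrightarrow> continuous_on S g \<Longrightarrow> continuous_on S (\<lambda>x. cross_sq (f x) (g x))"
  unfolding cross_sq_def by (intro continuous_intros)

lemma poly_growth_cross_sq:
  "poly_growth f \<Longrightarrow> poly_growth g \<Longrightarrow> poly_growth (\<lambda>x. cross_sq (f x) (g x))"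
  unfolding cross_sq_def power2_eq_square by (intro poly_growth_intros)

lemma sum_Basis_inner_mult:
  "(\<Sum>b\<in>Basis. (x \<bullet> b) * (y \<bullet> b)) = x \<bullet> (y::'a::euclidean_space)"
  by (simp add: euclidean_inner[of x y])

text \<open>The core of superharmonicity. Here \<open>fst v\<close> is the noise Z,
  \<open>snd v\<close> is the mixing matrix X, and \<open>e\<close> damps the mixture. The
  \<open>s\<close>-derivative of \<open>W\<close> is \<open>- (T \<bullet> Z) * W\<close> with
  \<open>T = (Y + s Z) X\<^sup>T X\<close>; one integration by parts in each variable shows that its
  integral is nonpositive. The damping makes all polynomial multiples of \<open>W\<close> integrable
  and adds only a term of favourable sign.\<close>

lemma gaussian_smoothing_decreasing:
  fixes Y :: "real^'p^'n"
  assumes card: "CARD('n) = CARD('p) + CARD('q) + 1" and e: "0 < e"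
    and s: "0 \<le> s0" "s0 \<le> s1"
  defines "W \<equiv> \<lambda>s (v::(real^'p^'n) \<times> (real^'p^'q)).
     exp (- ((norm (fst v))\<^sup>2 + e * (norm (snd v))\<^sup>2 + cross_sq (Y + s *\<^sub>R fst v) (snd v)) / 2)"
  shows "integrable lborel (W s)"
    and "(\<integral>v. W s1 v \<partial>lborel) \<le> (\<integral>v. W s0 v \<partial>lborel)"
proof -
  define T where "T = (\<lambda>s (v::(real^'p^'n) \<times> (real^'p^'q)). gram_act (Y + s *\<^sub>R fst v) (snd v))"
  define V where "V = (\<lambda>v::(real^'p^'n) \<times> (real^'p^'q). gram_act (snd v) (snd v))"
  note growth = poly_growth_intros poly_growth_gram_act poly_growth_cross_sq
  note cont = continuous_intros continuous_on_gram_act continuous_on_cross_sq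
  have Wc: "continuous_on UNIV (W s)" for s
    unfolding W_def by (intro cont) auto
  have Wb: "\<bar>W s v\<bar> \<le> 1 * exp (- (min 1 e / 2) * (norm v)\<^sup>2)" for s v
    unfolding W_def by (rule exp_gaussian_pair_bound[OF e cross_sq_nonneg])
  have int: "integrable lborel (\<lambda>v. f v * W s v)" if "poly_growth f" "continuous_on UNIV f" for f s
    by (rule integrable_poly_growth_gaussian[OF that(1) _ _ Wb])
       (use e that(2) Wc in \<open>auto intro!: borel_measurable_continuous_onI continuous_intros\<close>)
  show intW: "integrable lborel (W s)" for s
    using int[of "\<lambda>_. 1" s] by (simp add: poly_growth_const)
  have W0: "0 \<le> W s v" for s v by (simp add: W_def)
  have ibp: "integrable lborel (\<lambda>v. D v * W s v) \<and> (\<integral>v. D v * W s v \<partial>lborel) = 0"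
    if "\<And>v. ((\<lambda>t. f (v + t *\<^sub>R c) * W s (v + t *\<^sub>R c)) has_real_derivative D v * W s v) (at 0)"
       "poly_growth f" "continuous_on UNIV f" "poly_growth D" "continuous_on UNIV D" for f D c s
  proof (intro conjI integral_directional_derivative_eq_0 int)
    show "continuous_on UNIV (\<lambda>v. D v * W s v)" by (intro continuous_intros that Wc)
    show "(\<lambda>v. f v * W s v) \<in> borel_measurable borel"
      by (intro borel_measurable_continuous_onI continuous_intros that Wc)
    show "integrable lborel (\<lambda>v. f v * W s v)" by (intro int that)
  qed (use that in auto)

  \<comment> \<open>\<open>DZ s b v * W s v\<close> is the derivative along \<open>(b, 0)\<close> of
    \<open>(T s v \<bullet> b) * W s v\<close>. Its three terms come from \<open>T\<close>, from the
    Gaussian in Z and from the mixture exponent.\<close>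
  define DZ where "DZ = (\<lambda>s b v. s * (gram_act b (snd v) \<bullet> b) - (T s v \<bullet> b) * (fst v \<bullet> b)
    - s * ((T s v \<bullet> b) * (T s v \<bullet> b)))"
  have dZ: "integrable lborel (\<lambda>v. DZ s b v * W s v) \<and> (\<integral>v. DZ s b v * W s v \<partial>lborel) = 0" for s b
  proof (rule ibp[where c = "(b, 0)" and f = "\<lambda>v. T s v \<bullet> b"])
    fix v :: "(real^'p^'n) \<times> (real^'p^'q)"
    have 1: "((\<lambda>t. T s (v + t *\<^sub>R (b, 0)) \<bullet> b) has_real_derivative s * (gram_act b (snd v) \<bullet> b)) (at 0)"
    proof -
      have "T s (v + t *\<^sub>R (b, 0)) \<bullet> b = T s v \<bullet> b + t * (s * (gram_act b (snd v) \<bullet> b))" for t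
        using gram_act_add[of "Y + s *\<^sub>R fst v" "s * t" b "snd v"]
        by (simp add: T_def inner_add_left algebra_simps)
      then show ?thesis by (auto intro!: derivative_eq_intros)
    qed
    have 2: "((\<lambda>t. cross_sq (Y + s *\<^sub>R fst (v + t *\<^sub>R (b, 0))) (snd (v + t *\<^sub>R (b, 0))))
        has_real_derivative 2 * s * (T s v \<bullet> b)) (at 0)"
      using DERIV_cross_sq_left[of "Y + s *\<^sub>R fst v" s b "snd v"] by (simp add: T_def algebra_simps)
    have 3: "((\<lambda>t. (norm (fst (v + t *\<^sub>R (b, 0))))\<^sup>2) has_real_derivative 2 * (fst v \<bullet> b)) (at 0)"
      using DERIV_norm_sq_line[of "fst v" b] by simp
    have "((\<lambda>t. (norm (fst (v + t *\<^sub>R (b, 0))))\<^sup>2 + e * (norm (snd (v + t *\<^sub>R (b, 0))))\<^sup>2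
          + cross_sq (Y + s *\<^sub>R fst (v + t *\<^sub>R (b, 0))) (snd (v + t *\<^sub>R (b, 0))))
        has_real_derivative 2 * (fst v \<bullet> b) + 0 + 2 * s * (T s v \<bullet> b)) (at 0)"
      by (intro DERIV_add 2 3) simp
    note 4 = DERIV_mult_exp_half[OF 1 this]
    show "((\<lambda>t. (T s (v + t *\<^sub>R (b, 0)) \<bullet> b) * W s (v + t *\<^sub>R (b, 0))) has_real_derivative
       DZ s b v * W s v) (at 0)"
      unfolding W_def by (rule DERIV_cong[OF 4]) (simp add: DZ_def field_simps flip: zero_prod_def)
  qed (unfold T_def DZ_def, (intro growth | intro cont)+)
  \<comment> \<open>The analogue along \<open>(0, K)\<close> for the field \<open>V\<close>, that is
    \<open>X X\<^sup>T X\<close>: the terms come from \<open>V\<close>, from the damping and from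
    the mixture exponent.\<close>
  define DX where "DX = (\<lambda>s K v. (\<Sum>j\<in>UNIV. \<Sum>b\<in>UNIV. (snd v $ j \<bullet> snd v $ b) * (K $ j \<bullet> K $ b)
        + ((snd v $ j \<bullet> K $ b) + (K $ j \<bullet> snd v $ b)) * (K $ j \<bullet> snd v $ b))
       - e * ((V v \<bullet> K) * (snd v \<bullet> K)) - (V v \<bullet> K) * (gram_act (snd v) (Y + s *\<^sub>R fst v) \<bullet> K))"
  have dX: "integrable lborel (\<lambda>v. DX s K v * W s v) \<and> (\<integral>v. DX s K v * W s v \<partial>lborel) = 0" for s K
  proof (rule ibp[where c = "(0, K)" and f = "\<lambda>v. V v \<bullet> K"])
    fix v :: "(real^'p^'n) \<times> (real^'p^'q)"
    have 1: "((\<lambda>t. V (v + t *\<^sub>R (0, K)) \<bullet> K) has_real_derivative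
        (\<Sum>j\<in>UNIV. \<Sum>b\<in>UNIV. (snd v $ j \<bullet> snd v $ b) * (K $ j \<bullet> K $ b)
        + ((snd v $ j \<bullet> K $ b) + (K $ j \<bullet> snd v $ b)) * (K $ j \<bullet> snd v $ b))) (at 0)"
      using DERIV_gram_act_self[of "snd v" K] by (simp add: V_def)
    have 2: "((\<lambda>t. cross_sq (Y + s *\<^sub>R fst (v + t *\<^sub>R (0, K))) (snd (v + t *\<^sub>R (0, K))))
        has_real_derivative 2 * (gram_act (snd v) (Y + s *\<^sub>R fst v) \<bullet> K)) (at 0)"
      using DERIV_cross_sq_right[of "Y + s *\<^sub>R fst v" "snd v" K] by simp
    have 3: "((\<lambda>t. e * (norm (snd (v + t *\<^sub>R (0, K))))\<^sup>2) has_real_derivative e * (2 * (snd v \<bullet> K))) (at 0)"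
      using DERIV_cmult[OF DERIV_norm_sq_line[of "snd v" K], of e] by simp
    have "((\<lambda>t. (norm (fst (v + t *\<^sub>R (0, K))))\<^sup>2 + e * (norm (snd (v + t *\<^sub>R (0, K))))\<^sup>2
          + cross_sq (Y + s *\<^sub>R fst (v + t *\<^sub>R (0, K))) (snd (v + t *\<^sub>R (0, K))))
        has_real_derivative 0 + e * (2 * (snd v \<bullet> K)) + 2 * (gram_act (snd v) (Y + s *\<^sub>R fst v) \<bullet> K)) (at 0)"
      by (intro DERIV_add 2 3) simp
    note 4 = DERIV_mult_exp_half[OF 1 this]
    show "((\<lambda>t. (V (v + t *\<^sub>R (0, K)) \<bullet> K) * W s (v + t *\<^sub>R (0, K))) has_real_derivative
       DX s K v * W s v) (at 0)"
      unfolding W_def by (rule DERIV_cong[OF 4]) (simp add: DX_def field_simps flip: zero_prod_def)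
  qed (unfold V_def DX_def, (intro growth | intro cont)+)
  define n where "n = real CARD('n)"
  have sZ: "(\<Sum>b\<in>Basis. DZ s b v) = s * (n * (norm (snd v))\<^sup>2) - T s v \<bullet> fst v - s * (T s v \<bullet> T s v)" for s v
    by (simp add: DZ_def sum_subtractf sum_gram_act_Basis n_def sum_Basis_inner_mult flip: sum_distrib_left)
  \<comment> \<open>The cardinality hypothesis enters here: the divergence coefficient
    \<open>p + q + 1\<close> equals n, the trace coefficient in \<open>sZ\<close>. Cyclicity turns
    the last term of \<open>DX\<close> into \<open>T \<bullet> T\<close>.\<close>
  have sX: "(\<Sum>K\<in>Basis. DX s K v) = n * (norm (snd v))\<^sup>2 - e * cross_sq (snd v) (snd v) - T s v \<bullet> T s v" for s v
    using card
    by (simp add: DX_def sum_subtractf sum_DERIV_gram_act_self_Basis n_def sum_Basis_inner_mult V_def T_def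
       gram_act_inner_self gram_act_inner_gram_act flip: sum_distrib_left)
  have neg: "(\<integral>v. - (T s v \<bullet> fst v) * W s v \<partial>lborel) \<le> 0" if "0 \<le> s" for s
  proof -
    \<comment> \<open>Subtracting \<open>s\<close> times the identity in X from the identity in Z
      cancels both the squared norm of X and \<open>T \<bullet> T\<close>; only the radial term and
      the damping survive.\<close>
    have eq: "- (T s v \<bullet> fst v) * W s v = (\<Sum>b\<in>Basis. DZ s b v * W s v) - s * (\<Sum>K\<in>Basis. DX s K v * W s v)
       - s * e * (cross_sq (snd v) (snd v) * W s v)" for v
      unfolding sum_distrib_right[symmetric] sZ sX by (simp add: algebra_simps)
    have i: "integrable lborel (\<lambda>v. cross_sq (snd v) (snd v) * W s v)"
      by (rule int) (intro growth, intro cont)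
    have "(\<integral>v. - (T s v \<bullet> fst v) * W s v \<partial>lborel) = - s * e * (\<integral>v. cross_sq (snd v) (snd v) * W s v \<partial>lborel)"
      unfolding eq using dZ dX i
      by (simp add: Bochner_Integration.integral_sum Bochner_Integration.integrable_sum)
    also have "\<dots> \<le> 0"
      using that e by (auto intro!: mult_nonneg_nonneg Bochner_Integration.integral_nonneg cross_sq_nonneg W0)
    finally show ?thesis .
  qed
  have Teq: "T s v \<bullet> fst v = gram_act Y (snd v) \<bullet> fst v + s * cross_sq (fst v) (snd v)" for s v
    by (simp add: T_def gram_act_add inner_add_left gram_act_inner_self)
  \<comment> \<open>\<open>B * w\<close> dominates the \<open>s\<close>-derivative simultaneously
    for all \<open>s\<close> in \<open>{s0..s1}\<close>, which gives the uniform L1 bound.\<close>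
  define w where "w = (\<lambda>v::(real^'p^'n) \<times> (real^'p^'q). exp (- (min 1 e / 2) * (norm v)\<^sup>2))"
  define B where "B = (\<lambda>v::(real^'p^'n) \<times> (real^'p^'q). \<bar>gram_act Y (snd v) \<bullet> fst v\<bar> + s1 * \<bar>cross_sq (fst v) (snd v)\<bar>)"
  have intB: "integrable lborel (\<lambda>v. B v * w v)"
    unfolding B_def w_def
    by (rule integrable_poly_growth_gaussian[where K = 1 and c = "min 1 e / 2"])
       (use e in \<open>auto intro!: borel_measurable_continuous_onI growth cont\<close>)
  have "(\<integral>v. W s1 v \<partial>lborel) - (\<integral>v. W s0 v \<partial>lborel)
      = (\<integral>s. indicator {s0..s1} s * (\<integral>v. - (T s v \<bullet> fst v) * W s v \<partial>lborel) \<partial>lborel)"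
  proof (rule integral_FTC_parametric[where C = "\<integral>v. B v * w v \<partial>lborel"])
    show "((\<lambda>s. W s v) has_real_derivative - (T s v \<bullet> fst v) * W s v) (at s)" for s v
    proof -
      have "((\<lambda>t. 1 * W (s + t) v) has_real_derivative - (T s v \<bullet> fst v) * W s v) (at 0)"
        using DERIV_mult_exp_half[OF DERIV_const[of 1] DERIV_add[OF DERIV_const
            DERIV_cross_sq_left[of "Y + s *\<^sub>R fst v" 1 "fst v" "snd v"]],
            of "(norm (fst v))\<^sup>2 + e * (norm (snd v))\<^sup>2"]
        by (simp add: W_def T_def algebra_simps)
      then show ?thesis
        using DERIV_shift[of "\<lambda>s. W s v" _ 0 s] by (simp add: add.commute)
    qed
    show "continuous_on UNIV (\<lambda>(s, v). - (T s v \<bullet> fst v) * W s v)"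
      unfolding T_def W_def split_beta by (intro cont) auto
    show "integrable lborel (\<lambda>v. - (T s v \<bullet> fst v) * W s v)" for s
      unfolding T_def by (rule int) (intro growth, intro cont)
    show "(\<integral>v. \<bar>- (T s v \<bullet> fst v) * W s v\<bar> \<partial>lborel) \<le> (\<integral>v. B v * w v \<partial>lborel)" if "s \<in> {s0..s1}" for s
    proof (rule integral_mono[OF _ intB])
      show "integrable lborel (\<lambda>v. \<bar>- (T s v \<bullet> fst v) * W s v\<bar>)"
        unfolding T_def by (intro integrable_abs int) (intro growth, intro cont)
      show "\<bar>- (T s v \<bullet> fst v) * W s v\<bar> \<le> B v * w v" for v
      proof -
        have "\<bar>T s v \<bullet> fst v\<bar> \<le> \<bar>gram_act Y (snd v) \<bullet> fst v\<bar> + \<bar>s * cross_sq (fst v) (snd v)\<bar>"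
          unfolding Teq by (rule abs_triangle_ineq)
        also have "\<dots> \<le> B v"
          unfolding B_def abs_mult using that s by (intro add_left_mono mult_right_mono) auto
        finally show ?thesis
          unfolding abs_mult using Wb[of s v] by (intro mult_mono) (auto simp: w_def)
      qed
    qed
  qed (use s intW in auto)
  moreover have "0 \<le> (\<integral>s. - (indicator {s0..s1} s * (\<integral>v. - (T s v \<bullet> fst v) * W s v \<partial>lborel)) \<partial>lborel)"
    using neg s by (intro Bochner_Integration.integral_nonneg) (auto simp: indicator_def)
  ultimately show "(\<integral>v. W s1 v \<partial>lborel) \<le> (\<integral>v. W s0 v \<partial>lborel)" by simp
qed

section \<open>The Gaussian mixture representing the prior\<close>

text \<open>The values are in \<open>ennreal\<close> because the mixture is infinite at
  rank-deficient matrices. The \<open>itself\<close> argument fixes the number of rows of the mixing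
  matrix.\<close>

definition gauss_mix :: "'q::finite itself \<Rightarrow> real^'p^'n \<Rightarrow> ennreal" where
  "gauss_mix _ M = (\<integral>\<^sup>+X. ennreal (exp (- cross_sq M (X::real^'p^'q) / 2)) \<partial>lborel)"

lemma borel_measurable_cross_sq[measurable (raw)]:
  assumes "f \<in> borel_measurable N" "g \<in> borel_measurable N"
  shows "(\<lambda>x. cross_sq (f x) (g x)) \<in> borel_measurable N"
  by (rule borel_measurable_continuous_Pair[OF assms]) (intro continuous_on_cross_sq continuous_intros)

lemma gauss_mix_measurable[measurable]: "gauss_mix TYPE('q::finite) \<in> borel_measurable borel"
  unfolding gauss_mix_def[abs_def] by measurable

text \<open>Monotone convergence along \<open>1 / (k + 1)\<close> removes the damping, and Tonelli
  carries out the integral over X. Working in \<open>ennreal\<close> makes the comparison meaningful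
  before any finiteness is known; \<open>s0 = 0\<close> compares a smoothing with the value at
  \<open>Y\<close> itself.\<close>

lemma gauss_mix_smoothing_decreasing:
  fixes Y :: "real^'p^'n"
  assumes card: "CARD('n) = CARD('p) + CARD('q::finite) + 1"
    and s: "0 \<le> s0" "s0 \<le> s1"
  shows "(\<integral>\<^sup>+Z. ennreal (exp (- (norm Z)\<^sup>2 / 2)) * gauss_mix TYPE('q) (Y + s1 *\<^sub>R Z) \<partial>lborel)
       \<le> (\<integral>\<^sup>+Z. ennreal (exp (- (norm Z)\<^sup>2 / 2)) * gauss_mix TYPE('q) (Y + s0 *\<^sub>R Z) \<partial>lborel)"
proof -
  define W where "W = (\<lambda>e s (v::(real^'p^'n) \<times> (real^'p^'q)).
     exp (- ((norm (fst v))\<^sup>2 + e * (norm (snd v))\<^sup>2 + cross_sq (Y + s *\<^sub>R fst v) (snd v)) / 2))"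
  have Wm: "(\<lambda>v. ennreal (W e s v)) \<in> borel_measurable borel" for e s
    unfolding W_def borel_prod[symmetric] by measurable
  have 1: "(\<integral>\<^sup>+v. W e s1 v \<partial>lborel) \<le> (\<integral>\<^sup>+v. W e s0 v \<partial>lborel)" if "0 < e" for e
    using gaussian_smoothing_decreasing[where 'q = 'q, OF card that s, of Y]
    unfolding W_def by (simp add: nn_integral_eq_integral)
  define e where "e = (\<lambda>k::nat. inverse (real (Suc k)))"
  have e: "0 < e k" "e (Suc k) \<le> e k" for k
    by (simp_all add: e_def field_simps)
  have mono: "W (e k) s v \<le> W (e (Suc k)) s v" for k s v
    unfolding W_def using mult_right_mono[OF e(2)[of k], of "(norm (snd v))\<^sup>2"] by simp
  have sup: "(SUP k. ennreal (W (e k) s v)) = ennreal (W 0 s v)" for s v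
  proof -
    have "(\<lambda>k. W (e k) s v) \<longlonglongrightarrow> W 0 s v"
      unfolding W_def e_def by (intro tendsto_intros LIMSEQ_inverse_real_of_nat) auto
    then have "(\<lambda>k. ennreal (W (e k) s v)) \<longlonglongrightarrow> ennreal (W 0 s v)"
      by (intro tendsto_ennrealI)
    moreover have "(\<lambda>k. ennreal (W (e k) s v)) \<longlonglongrightarrow> (SUP k. ennreal (W (e k) s v))"
      by (intro LIMSEQ_SUP incseq_SucI ennreal_leI mono)
    ultimately show ?thesis by (rule LIMSEQ_unique[symmetric])
  qed
  have 2: "(\<integral>\<^sup>+v. W 0 s v \<partial>lborel) = (SUP k. \<integral>\<^sup>+v. W (e k) s v \<partial>lborel)" for s
    unfolding sup[symmetric]
    by (rule nn_integral_monotone_convergence_SUP)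
       (auto intro!: incseq_SucI le_funI ennreal_leI mono simp: Wm)
  have 3: "(\<integral>\<^sup>+v. W 0 s v \<partial>lborel)
      = (\<integral>\<^sup>+Z. ennreal (exp (- (norm Z)\<^sup>2 / 2)) * gauss_mix TYPE('q) (Y + s *\<^sub>R Z) \<partial>lborel)" for s
  proof -
    have "(\<integral>\<^sup>+v. W 0 s v \<partial>lborel) = (\<integral>\<^sup>+Z. \<integral>\<^sup>+X. W 0 s (Z, X) \<partial>lborel \<partial>lborel)"
      by (subst lborel.nn_integral_fst) (simp_all add: lborel_prod Wm)
    also have "\<dots> = (\<integral>\<^sup>+Z. ennreal (exp (- (norm Z)\<^sup>2 / 2)) * gauss_mix TYPE('q) (Y + s *\<^sub>R Z) \<partial>lborel)"
      unfolding gauss_mix_def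
      by (subst nn_integral_cmult[symmetric])
         (simp_all add: W_def ennreal_mult[symmetric] exp_add[symmetric] add_divide_distrib diff_divide_distrib)
    finally show ?thesis .
  qed
  show ?thesis
    unfolding 3[symmetric] 2 by (intro SUP_mono) (use 1 e in blast)
qed

section \<open>Linear change of variables acting on rows\<close>

text \<open>Split off the coordinate along \<open>v\<close> by Fubini. On each line in that
  direction \<open>x \<bullet> u\<close> is constant, since \<open>u\<close> and \<open>v\<close>
  are distinct basis vectors, so the shear is a translation there.\<close>

lemma nn_integral_lborel_shear:
  fixes u v :: "'a::euclidean_space"
  assumes uv: "u \<in> Basis" "v \<in> Basis" "u \<noteq> v" and [measurable]: "f \<in> borel_measurable borel"
  shows "(\<integral>\<^sup>+x. f (x + (c * (x \<bullet> u)) *\<^sub>R v) \<partial>lborel) = (\<integral>\<^sup>+x. f x \<partial>lborel)"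
proof -
  interpret product_sigma_finite "\<lambda>_::'a. lborel :: real measure" ..
  define E where "E = (\<lambda>y::'a \<Rightarrow> real. \<Sum>b\<in>Basis. y b *\<^sub>R b)"
  have Em: "E \<in> (\<Pi>\<^sub>M b\<in>Basis. lborel) \<rightarrow>\<^sub>M borel" unfolding E_def by measurable
  define B where "B = (Basis::'a set) - {v}"
  have B: "Basis = insert v B" "finite B" "v \<notin> B" using uv by (auto simp: B_def)
  have Einner: "E y \<bullet> b = y b" if "b \<in> Basis" for y b
    using that by (simp add: E_def inner_sum_left inner_Basis if_distrib cong: if_cong)
  have Eupd: "E (y(v := t)) = E (y(v := 0)) + t *\<^sub>R v" for y t
  proof (rule euclidean_eqI)
    fix b :: 'a assume "b \<in> Basis"
    then show "E (y(v := t)) \<bullet> b = (E (y(v := 0)) + t *\<^sub>R v) \<bullet> b"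
      using uv by (auto simp: Einner inner_add_left inner_Basis)
  qed
  \<comment> \<open>Since \<open>y\<close> ranges over functions on \<open>B\<close> only, the
    update at \<open>v\<close> fixes a base point on each line.\<close>
  have split: "(\<integral>\<^sup>+x. g x \<partial>lborel) = (\<integral>\<^sup>+y. \<integral>\<^sup>+t. g (E (y(v := 0)) + t *\<^sub>R v) \<partial>lborel \<partial>(\<Pi>\<^sub>M b\<in>B. lborel))"
    if [measurable]: "g \<in> borel_measurable borel" for g :: "'a \<Rightarrow> ennreal"
  proof -
    have "(\<integral>\<^sup>+x. g x \<partial>lborel) = (\<integral>\<^sup>+y. g (E y) \<partial>(\<Pi>\<^sub>M b\<in>Basis. lborel))"
      by (subst lborel_eq) (use Em in \<open>simp add: nn_integral_distr E_def\<close>)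
    also have "\<dots> = (\<integral>\<^sup>+y. \<integral>\<^sup>+t. g (E (y(v := t))) \<partial>lborel \<partial>(\<Pi>\<^sub>M b\<in>B. lborel))"
      unfolding B(1) by (rule product_nn_integral_insert)
        (use B measurable_compose[OF Em that] in simp_all)
    also have "\<dots> = (\<integral>\<^sup>+y. \<integral>\<^sup>+t. g (E (y(v := 0)) + t *\<^sub>R v) \<partial>lborel \<partial>(\<Pi>\<^sub>M b\<in>B. lborel))"
      by (intro nn_integral_cong arg_cong[where f = g] Eupd)
    finally show ?thesis .
  qed
  have "(\<integral>\<^sup>+x. f (x + (c * (x \<bullet> u)) *\<^sub>R v) \<partial>lborel)
     = (\<integral>\<^sup>+y. \<integral>\<^sup>+t. f (E (y(v := 0)) + (c * y u + 1 * t) *\<^sub>R v) \<partial>lborel \<partial>(\<Pi>\<^sub>M b\<in>B. lborel))"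
    using uv by (subst split) (simp_all add: inner_add_left Einner inner_Basis algebra_simps)
  also have "\<dots> = (\<integral>\<^sup>+y. \<integral>\<^sup>+t. f (E (y(v := 0)) + t *\<^sub>R v) \<partial>lborel \<partial>(\<Pi>\<^sub>M b\<in>B. lborel))"
  proof (rule nn_integral_cong)
    fix y
    show "(\<integral>\<^sup>+t. f (E (y(v := 0)) + (c * y u + 1 * t) *\<^sub>R v) \<partial>lborel) = (\<integral>\<^sup>+t. f (E (y(v := 0)) + t *\<^sub>R v) \<partial>lborel)"
      using nn_integral_real_affine[of "\<lambda>t. f (E (y(v := 0)) + t *\<^sub>R v)" 1 "c * y u"] by simp
  qed
  also have "\<dots> = (\<integral>\<^sup>+x. f x \<partial>lborel)" by (rule split[symmetric]) simp
  finally show ?thesis .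
qed

lemma matrix_shear_vector_mult:
  fixes x :: "real^'p"
  assumes "m \<noteq> n"
  shows "(\<chi> i j. if i = m \<and> j = n then c else of_bool (i = j)) *v x = x + (c * x $ n) *\<^sub>R axis m 1"
proof -
  have "(if i = m \<and> j = n then c else of_bool (i = j)) * x $ j
      = (if j = i then x $ j else 0) + (if j = n then (if i = m then c * x $ n else 0) else 0)" for i j
    using assms by auto
  then show ?thesis
    by (simp add: vec_eq_iff matrix_vector_mult_def sum.distrib axis_def)
qed

lemma det_matrix_shear:
  assumes "m \<noteq> n"
  shows "det (\<chi> i j. if i = m \<and> j = n then c else of_bool (i = j) :: real^'p^'p) = 1"
proof -
  have "(\<chi> i j. if i = m \<and> j = n then c else of_bool (i = j))
      = (\<chi> k. if k = m then row m (mat 1) + c *s row n (mat 1) else row k (mat 1 :: real^'p^'p))"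
    using assms by (auto simp: vec_eq_iff row_def mat_def)
  then show ?thesis using det_row_operation[OF assms, of "mat 1 :: real^'p^'p"] by simp
qed

text \<open>\<open>E m n c\<close> adds \<open>c\<close> times coordinate \<open>n\<close> to
  coordinate \<open>m\<close>. Three such shears exchange two coordinates up to a sign, which the
  diagonal factor corrects; swaps thereby reduce to shears and diagonal matrices.\<close>

lemma swap_matrix_eq:
  fixes m n :: "'p::finite"
  assumes "m \<noteq> n"
  defines "E \<equiv> \<lambda>m n c. (\<chi> i j. if i = m \<and> j = n then c else of_bool (i = j)) :: real^'p^'p"
  shows "(\<chi> i j. mat 1 $ i $ Transposition.transpose m n j)
     = E m n 1 ** (E n m (-1) ** (E m n 1 ** (\<chi> i j. if i = j then (if i = m then -1 else 1) else 0)))"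
proof -
  have swap: "((\<chi> i j. mat 1 $ i $ Transposition.transpose m n j) :: real^'p^'p) *v x = (\<chi> i. x $ Transposition.transpose m n i)" for x
  proof -
    have "(\<Sum>j\<in>UNIV. mat 1 $ i $ Transposition.transpose m n j * x $ j)
       = (\<Sum>j\<in>UNIV. if j = Transposition.transpose m n i then x $ j else 0)" for i
      by (rule sum.cong) (auto simp: mat_def)
    then show ?thesis by (simp add: vec_eq_iff matrix_vector_mult_def)
  qed
  have D: "((\<chi> i j. if i = j then (if i = m then -1 else 1) else 0) :: real^'p^'p) *v x
      = (\<chi> i. if i = m then - x $ i else x $ i)" for x
  proof -
    have "(\<Sum>j\<in>UNIV. (if i = j then (if i = m then -1 else 1) else 0) * x $ j)
       = (\<Sum>j\<in>UNIV. if j = i then (if i = m then - x $ i else x $ i) else 0)" for i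
      by (rule sum.cong) auto
    then show ?thesis by (simp add: vec_eq_iff matrix_vector_mult_def)
  qed
  show ?thesis
    unfolding matrix_eq matrix_vector_mul_assoc[symmetric] swap D E_def
    using assms(1)
    by (simp add: matrix_shear_vector_mult vec_eq_iff axis_def transpose_def)
qed

text \<open>Each of the q rows contributes one factor \<open>\<bar>det R\<bar>\<close> to the
  Jacobian. The formula is multiplicative in \<open>R\<close>, which reduces it to diagonal matrices
  and shears.\<close>

lemma nn_integral_lborel_rows_linear:
  fixes R :: "real^'p^'p" and f :: "real^'p^'q \<Rightarrow> ennreal"
  assumes "det R \<noteq> 0" and "f \<in> borel_measurable borel"
  shows "(\<integral>\<^sup>+X. f X \<partial>lborel) = ennreal (\<bar>det R\<bar> ^ CARD('q)) * (\<integral>\<^sup>+X. f (\<chi> j. R *v X $ j) \<partial>lborel)"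
proof -
  \<comment> \<open>The condition on the determinant sits inside \<open>P\<close>: the induction
    over elementary matrices also meets singular ones, and the zero-row case then holds
    vacuously.\<close>
  define P where "P = (\<lambda>R. det R \<noteq> 0 \<longrightarrow> (\<forall>f::real^'p^'q \<Rightarrow> ennreal. f \<in> borel_measurable borel \<longrightarrow>
      (\<integral>\<^sup>+X. f X \<partial>lborel) = ennreal (\<bar>det R\<bar> ^ CARD('q)) * (\<integral>\<^sup>+X. f (\<chi> j. R *v X $ j) \<partial>lborel)))"
  have act: "(\<lambda>X::real^'p^'q. \<chi> j. A *v X $ j) \<in> borel_measurable borel" for A :: "real^'p^'p"
    by (intro borel_measurable_continuous_onI continuous_intros
        bounded_linear.continuous_on[OF matrix_vector_mul_bounded_linear])
  have mult: "P (A ** B)" if "P A" "P B" for A B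
    unfolding P_def
  proof (intro impI allI)
    fix f :: "real^'p^'q \<Rightarrow> ennreal"
    assume "det (A ** B) \<noteq> 0" and f: "f \<in> borel_measurable borel"
    then have d: "det A \<noteq> 0" "det B \<noteq> 0" by (simp_all add: det_mul)
    have "(\<integral>\<^sup>+X. f X \<partial>lborel) = ennreal (\<bar>det A\<bar> ^ CARD('q)) * (\<integral>\<^sup>+X. f (\<chi> j. A *v X $ j) \<partial>lborel)"
      using \<open>P A\<close> d f unfolding P_def by blast
    also have "(\<integral>\<^sup>+X. f (\<chi> j. A *v X $ j) \<partial>lborel)
        = ennreal (\<bar>det B\<bar> ^ CARD('q)) * (\<integral>\<^sup>+X. f (\<chi> j. A *v (\<chi> j. B *v X $ j) $ j) \<partial>lborel)"
      using \<open>P B\<close> d measurable_compose[OF act f] unfolding P_def by blast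
    finally show "(\<integral>\<^sup>+X. f X \<partial>lborel) = ennreal (\<bar>det (A ** B)\<bar> ^ CARD('q)) * (\<integral>\<^sup>+X. f (\<chi> j. (A ** B) *v X $ j) \<partial>lborel)"
      by (simp add: det_mul abs_mult power_mult_distrib ennreal_mult mult.assoc matrix_vector_mul_assoc)
  qed
  have diag: "P A" if A: "\<And>i j. i \<noteq> j \<Longrightarrow> A $ i $ j = 0" for A
    unfolding P_def
  proof (intro impI allI)
    fix f :: "real^'p^'q \<Rightarrow> ennreal"
    assume d: "det A \<noteq> 0" and f[measurable]: "f \<in> borel_measurable borel"
    have dA: "det A = (\<Prod>i\<in>UNIV. A $ i $ i)" using det_diagonal[OF A] by simp
    \<comment> \<open>On a basis matrix this sum reads off the diagonal entry scaling that
      coordinate, without a choice of indices.\<close>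
    define c where "c = (\<lambda>b::real^'p^'q. \<Sum>j\<in>UNIV. \<Sum>i\<in>UNIV. A $ i $ i * b $ j $ i)"
    have c: "c (axis j (axis i 1)) = A $ i $ i" for j i
    proof -
      have "(\<Sum>k\<in>UNIV. A $ k $ k * (axis j (axis i 1) :: real^'p^'q) $ l $ k) = (if l = j then A $ i $ i else 0)" for l
        by (simp add: axis_def if_distrib cong: if_cong)
      then show ?thesis by (simp add: c_def)
    qed
    have cb: "\<exists>j i. b = axis j (axis i 1)" if "b \<in> Basis" for b :: "real^'p^'q"
      using that by (auto simp: Basis_vec_def)
    have c0: "c b \<noteq> 0" if "b \<in> Basis" for b
      using cb[OF that] c d by (auto simp: dA)
    have T: "0 + (\<Sum>b\<in>Basis. (c b * (X \<bullet> b)) *\<^sub>R b) = (\<chi> j. A *v X $ j)" for X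
    proof (rule euclidean_eqI)
      fix b :: "real^'p^'q" assume b: "b \<in> Basis"
      then obtain j i where ji: "b = axis j (axis i 1)" using cb by blast
      have "(\<chi> j. A *v X $ j) \<bullet> b = (\<Sum>k\<in>UNIV. A $ i $ k * X $ j $ k)"
        by (simp add: ji inner_axis matrix_vector_mult_def)
      also have "\<dots> = (\<Sum>k\<in>UNIV. if k = i then A $ i $ i * X $ j $ i else 0)"
        by (rule sum.cong) (auto simp: A)
      finally show "(0 + (\<Sum>b\<in>Basis. (c b * (X \<bullet> b)) *\<^sub>R b)) \<bullet> b = (\<chi> j. A *v X $ j) \<bullet> b"
        using b by (simp add: inner_sum_left inner_Basis if_distrib cong: if_cong)
          (simp add: ji c inner_axis)
    qed
    have pr: "(\<Prod>b\<in>Basis. \<bar>c b\<bar>) = \<bar>det A\<bar> ^ CARD('q)"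
      unfolding prod_Basis_matrix by (simp add: c dA abs_prod)
    have "(lborel :: (real^'p^'q) measure) = density (distr lborel borel (\<lambda>X. \<chi> j. A *v X $ j)) (\<lambda>_. ennreal (\<bar>det A\<bar> ^ CARD('q)))"
      by (rule lborel_affine_euclidean[of c 0, OF c0, unfolded T pr])
    then have "(\<integral>\<^sup>+X. f X \<partial>lborel) = (\<integral>\<^sup>+X. f X \<partial>density (distr lborel borel (\<lambda>X. \<chi> j. A *v X $ j)) (\<lambda>_. ennreal (\<bar>det A\<bar> ^ CARD('q))))"
      by simp
    also have "\<dots> = ennreal (\<bar>det A\<bar> ^ CARD('q)) * (\<integral>\<^sup>+X. f (\<chi> j. A *v X $ j) \<partial>lborel)"
      using act[of A] by (simp add: nn_integral_density nn_integral_distr nn_integral_cmult)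
    finally show "(\<integral>\<^sup>+X. f X \<partial>lborel) = ennreal (\<bar>det A\<bar> ^ CARD('q)) * (\<integral>\<^sup>+X. f (\<chi> j. A *v X $ j) \<partial>lborel)" .
  qed
  have shear: "P (\<chi> i j. if i = m \<and> j = n then c else of_bool (i = j))" (is "P ?A") if mn: "m \<noteq> n" for m n c
    unfolding P_def
  proof (intro impI allI)
    fix f :: "real^'p^'q \<Rightarrow> ennreal"
    assume f[measurable]: "f \<in> borel_measurable borel"
    \<comment> \<open>Shear the rows one at a time: those in \<open>J\<close> are done, and a
      further row costs a single shear of the whole matrix space along a basis matrix.\<close>
    have "(\<integral>\<^sup>+X. f (\<chi> j. if j \<in> J then ?A *v X $ j else X $ j) \<partial>lborel) = (\<integral>\<^sup>+X. f X \<partial>lborel)" for J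
    proof (induction J rule: infinite_finite_induct)
      case (insert k J)
      define g where "g = (\<lambda>X. f (\<chi> j. if j \<in> J then ?A *v X $ j else X $ j))"
      have "continuous_on UNIV (\<lambda>X::real^'p^'q. if j \<in> J then ?A *v X $ j else X $ j)" for j
        by (cases "j \<in> J") (auto intro!: continuous_intros
            bounded_linear.continuous_on[OF matrix_vector_mul_bounded_linear])
      then have "(\<lambda>X::real^'p^'q. \<chi> j. if j \<in> J then ?A *v X $ j else X $ j) \<in> borel_measurable borel"
        by (intro borel_measurable_continuous_onI continuous_on_vec_lambda)
      then have gm: "g \<in> borel_measurable borel" unfolding g_def by measurable
      have "f (\<chi> j. if j \<in> insert k J then ?A *v X $ j else X $ j)
          = g (X + (c * (X \<bullet> axis k (axis n 1))) *\<^sub>R axis k (axis m 1))" for X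
        unfolding g_def matrix_shear_vector_mult[OF mn] inner_axis
        by (rule arg_cong[of _ _ f]) (use insert in \<open>auto simp: vec_eq_iff axis_def\<close>)
      then have "(\<integral>\<^sup>+X. f (\<chi> j. if j \<in> insert k J then ?A *v X $ j else X $ j) \<partial>lborel) = (\<integral>\<^sup>+X. g X \<partial>lborel)"
        using mn by (simp add: nn_integral_lborel_shear[OF _ _ _ gm] Basis_vec_def axis_eq_axis)
      then show ?case using insert.IH by (simp add: g_def)
    qed simp_all
    from this[of UNIV]
    show "(\<integral>\<^sup>+X. f X \<partial>lborel) = ennreal (\<bar>det ?A\<bar> ^ CARD('q)) * (\<integral>\<^sup>+X. f (\<chi> j. ?A *v X $ j) \<partial>lborel)"
      by (simp add: det_matrix_shear[OF mn])
  qed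
  have "P R"
  proof (rule induct_matrix_elementary)
    show "P (\<chi> i j. mat 1 $ i $ Transposition.transpose m n j)" if "m \<noteq> n" for m n
      unfolding swap_matrix_eq[OF that] by (intro mult shear diag) (use that in auto)
    show "P A" if "row i A = 0" for A i
      using det_zero_row[OF that] by (simp add: P_def)
  qed (use mult diag shear in blast)+
  with assms show ?thesis by (simp add: P_def)
qed

section \<open>Identification of the mixture with the singular value shrinkage prior\<close>

lemma cross_sq_eq_norm_mult:
  "cross_sq M X = (\<Sum>j\<in>UNIV. (norm (M *v X $ j))\<^sup>2)"
proof -
  have "(norm (M *v x))\<^sup>2 = (\<Sum>a\<in>UNIV. (M $ a \<bullet> x)\<^sup>2)" for x
    unfolding power2_norm_eq_inner
    by (simp add: inner_vec_def[of "M *v x"] matrix_vector_mul_component power2_eq_square)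
  then show ?thesis
    unfolding cross_sq_def by (subst sum.swap) simp
qed

lemma sum_norm_rows: "(\<Sum>j\<in>UNIV. (norm (X $ j))\<^sup>2) = (norm (X :: real^'p^'q))\<^sup>2"
  unfolding power2_norm_eq_inner by (simp add: inner_vec_def)

lemma gauss_mix_mult:
  fixes M :: "real^'p^'n" and R :: "real^'p^'p"
  assumes "det R \<noteq> 0"
  shows "gauss_mix TYPE('q::finite) M = ennreal (\<bar>det R\<bar> ^ CARD('q)) * gauss_mix TYPE('q) (M ** R)"
proof -
  have "cross_sq (M ** R) X = cross_sq M (\<chi> j. R *v X $ j)" for X :: "real^'p^'q"
    by (simp add: cross_sq_eq_norm_mult matrix_vector_mul_assoc)
  then show ?thesis
    unfolding gauss_mix_def by (subst nn_integral_lborel_rows_linear[OF assms]) simp_all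
qed

lemma gauss_mix_neq_0: "gauss_mix TYPE('q::finite) (M :: real^'p^'n) \<noteq> 0"
proof
  assume "gauss_mix TYPE('q) M = 0"
  then have "AE X in (lborel :: (real^'p^'q) measure). False"
    unfolding gauss_mix_def by (subst (asm) nn_integral_0_iff_AE) (simp_all)
  then have "emeasure (lborel :: (real^'p^'q) measure) UNIV = 0"
    by (simp add: AE_iff_measurable[OF _ refl])
  then show False by simp
qed

text \<open>A substitute for the polar decomposition: the range of \<open>M\<close> has dimension at
  most p, so an isometry carries it into p-dimensional space, and composition with \<open>M\<close>
  gives a square matrix. Polarisation recovers the Gram matrix from the norms.\<close>

lemma exists_square_factor:
  fixes M :: "real^'p^'n"
  obtains R :: "real^'p^'p" where "\<And>x. norm (M *v x) = norm (R *v x)" "transpose M ** M = transpose R ** R"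
proof -
  let ?S = "range (\<lambda>x. M *v x)"
  have lM: "linear (\<lambda>x. M *v x)" by (rule matrix_vector_mul_linear)
  have "subspace ?S" using linear_subspace_image[OF lM subspace_UNIV] by simp
  moreover have "dim ?S \<le> dim (UNIV :: (real^'p) set)"
    by (metis dim_subset_UNIV dim_UNIV dim_image_le lM)
  ultimately obtain f :: "real^'n \<Rightarrow> real^'p" where f: "linear f" "\<And>x. x \<in> ?S \<Longrightarrow> norm (f x) = norm x"
    using isometry_subset_subspace[of ?S "UNIV :: (real^'p) set"] by (metis subspace_UNIV)
  define R where "R = matrix (\<lambda>x. f (M *v x))"
  have R: "R *v x = f (M *v x)" for x
    unfolding R_def
    using fun_cong[OF matrix_vector_mul(2)[OF linear_compose[OF lM f(1), unfolded o_def]]] by simp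
  have n: "norm (M *v x) = norm (R *v x)" for x
    by (simp add: R f(2))
  have inn: "(A *v x) \<bullet> (A *v y) = ((norm (A *v (x + y)))\<^sup>2 - (norm (A *v x))\<^sup>2 - (norm (A *v y))\<^sup>2) / 2"
    for A :: "real^'p^'k" and x y
    by (simp add: matrix_vector_right_distrib power2_norm_eq_inner inner_add_left inner_add_right inner_commute)
  have ent: "(transpose A ** A) $ i $ j = (A *v axis i 1) \<bullet> (A *v axis j 1)" for A :: "real^'p^'k" and i j
    by (simp add: matrix_matrix_mult_def transpose_def matrix_vector_mult_basis column_def inner_vec_def)
  have "transpose M ** M = transpose R ** R"
    unfolding vec_eq_iff ent inn n by simp
  with n that show thesis by blast
qed

text \<open>A kernel vector of \<open>M\<close> yields \<open>B\<close> with \<open>M B = M\<close> and \<open>det B = 2\<close>, so the mixture at \<open>M\<close>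
  equals \<open>2\<^sup>q\<close> times itself.\<close>

lemma gauss_mix_singular:
  fixes M :: "real^'p^'n"
  assumes "det (transpose M ** M) = 0"
  shows "gauss_mix TYPE('q::finite) M = \<infinity>"
proof -
  obtain R :: "real^'p^'p" where R: "\<And>x. norm (M *v x) = norm (R *v x)" "transpose M ** M = transpose R ** R"
    using exists_square_factor[of M] by blast
  have "det R = 0" using assms by (simp add: R(2) det_mul)
  then obtain u where u: "u \<noteq> 0" "R *v u = 0"
    using invertible_det_nz[of R] invertible_left_inverse[of R] matrix_left_invertible_ker[of R] by metis
  then obtain k where k: "u $ k \<noteq> 0" by (metis vec_eq_iff zero_index)
  define v where "v = (1 / u $ k) *\<^sub>R u"
  have v: "v $ k = 1" "M *v v = 0"
    using k u(2) R(1)[of u] by (simp_all add: v_def matrix_vector_mult_scaleR)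
  \<comment> \<open>\<open>B\<close> is the identity with \<open>v\<close> added to column
    \<open>k\<close>. Writing that column as \<open>mat 1 *v x\<close> fits
    \<open>cramer_lemma\<close>, and \<open>v $ k = 1\<close> makes the determinant 2.\<close>
  define B :: "real^'p^'p" where
    "B = (\<chi> i j. if j = k then (mat 1 *v (axis k 1 + v)) $ i else mat 1 $ i $ j)"
  have dB: "det B = 2" unfolding B_def cramer_lemma using v by (simp add: axis_def)
  have "B *v x = x + (x $ k) *\<^sub>R v" for x
  proof -
    have "(if j = k then (axis k 1 + v) $ i else mat 1 $ i $ j) * x $ j
        = (if j = i then x $ j else 0) + (if j = k then v $ i * x $ k else 0)" for i j
      by (auto simp: mat_def axis_def algebra_simps)
    moreover have "B = (\<chi> i j. if j = k then (axis k 1 + v) $ i else mat 1 $ i $ j)"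
      unfolding B_def by (simp only: matrix_vector_mul_lid)
    ultimately show ?thesis
      by (simp add: vec_eq_iff matrix_vector_mult_def sum.distrib)
  qed
  then have "M ** B = M"
    using v by (simp add: matrix_eq matrix_vector_mul_assoc[symmetric] matrix_vector_right_distrib
        matrix_vector_mult_scaleR)
  then have eq: "gauss_mix TYPE('q) M = ennreal (2 ^ CARD('q)) * gauss_mix TYPE('q) M"
    using gauss_mix_mult[of B M, where 'q = 'q] dB by simp
  show ?thesis
  proof (rule ccontr)
    assume "gauss_mix TYPE('q) M \<noteq> \<infinity>"
    then obtain r where r: "gauss_mix TYPE('q) M = ennreal r" "0 \<le> r"
      by (cases "gauss_mix TYPE('q) M") auto
    then have "r = 2 ^ CARD('q) * r"
      using eq by (simp add: ennreal_mult[symmetric])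
    moreover have "1 < (2::real) ^ CARD('q)" by (rule one_less_power) simp_all
    ultimately have "r = 0" by simp
    then show False using r gauss_mix_neq_0[of M, where 'q = 'q] by simp
  qed
qed

text \<open>The total mass of the unnormalised standard Gaussian on q x p matrices, that is
  \<open>(2 * pi) powr (p * q / 2)\<close>.\<close>

definition gauss_const :: "('p::finite) itself \<Rightarrow> ('q::finite) itself \<Rightarrow> real" where
  "gauss_const _ _ = (\<integral>X. exp (- (norm (X::real^'p^'q))\<^sup>2 / 2) \<partial>lborel)"

lemma nn_integral_gauss:
  "(\<integral>\<^sup>+X. ennreal (exp (- (norm (X::real^'p^'q))\<^sup>2 / 2)) \<partial>lborel) = ennreal (gauss_const TYPE('p) TYPE('q))"
  unfolding gauss_const_def
  using integrable_gaussian[of "1/2", where 'a = "real^'p^'q"]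
  by (intro nn_integral_eq_integral) simp_all

lemma gauss_mix_isometry:
  fixes M :: "real^'p^'n"
  assumes "\<And>x. norm (M *v x) = norm x"
  shows "gauss_mix TYPE('q::finite) M = ennreal (gauss_const TYPE('p) TYPE('q))"
  unfolding gauss_mix_def cross_sq_eq_norm_mult assms sum_norm_rows by (rule nn_integral_gauss)

lemma gauss_const_pos: "0 < gauss_const TYPE('p::finite) TYPE('q::finite)"
  using gauss_mix_isometry[of "mat 1 :: real^'p^'p", where 'q = 'q]
    gauss_mix_neq_0[of "mat 1 :: real^'p^'p", where 'q = 'q]
  by (simp add: ennreal_eq_0_iff not_le)

lemma det_gram_nonneg: "0 \<le> det (transpose M ** (M :: real^'p^'n))"
  using exists_square_factor[of M] by (metis det_mul det_transpose zero_le_square)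

text \<open>Pass to a square \<open>R\<close> with the same norms. Substitution by \<open>R\<close>
  relates the mixture at \<open>R\<close> to the one at the identity by the factor
  \<open>\<bar>det R\<bar> ^ q\<close>, and \<open>det (M\<^sup>T M)\<close> is the square of
  \<open>det R\<close>. Full rank matters: at a rank-deficient \<open>M\<close> the convention for
  \<open>powr\<close> gives \<open>pi_SVS M = 0\<close>, while the mixture is infinite.\<close>

lemma gauss_mix_eq_pi_SVS:
  fixes M :: "real^'p^'n"
  assumes card: "CARD('n) = CARD('p) + CARD('q::finite) + 1"
    and d: "det (transpose M ** M) \<noteq> 0"
  shows "gauss_mix TYPE('q) M = ennreal (gauss_const TYPE('p) TYPE('q)) * ennreal (pi_SVS M)"
proof -
  obtain R :: "real^'p^'p" where R: "\<And>x. norm (M *v x) = norm (R *v x)" "transpose M ** M = transpose R ** R"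
    using exists_square_factor[of M] by blast
  have dR: "det R \<noteq> 0" using d by (simp add: R(2) det_mul)
  have "gauss_mix TYPE('q) M = gauss_mix TYPE('q) R"
    by (simp add: gauss_mix_def cross_sq_eq_norm_mult R(1))
  moreover have "ennreal (gauss_const TYPE('p) TYPE('q)) = ennreal (\<bar>det R\<bar> ^ CARD('q)) * gauss_mix TYPE('q) R"
    using gauss_mix_mult[OF dR, of "mat 1 :: real^'p^'p", where 'q = 'q]
    by (simp add: gauss_mix_isometry)
  moreover have "pi_SVS M = 1 / \<bar>det R\<bar> ^ CARD('q)"
  proof -
    have "det (transpose M ** M) = (det R)\<^sup>2"
      by (simp add: R(2) det_mul power2_eq_square)
    moreover have "(det R)\<^sup>2 = \<bar>det R\<bar> powr 2"
      using dR by simp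
    then have "(det R)\<^sup>2 powr (real CARD('q) / 2) = \<bar>det R\<bar> ^ CARD('q)"
      using dR by (simp add: powr_powr powr_realpow del: powr_numeral)
    ultimately show ?thesis
      using card by (simp add: pi_SVS_def powr_minus_divide)
  qed
  moreover have "ennreal (\<bar>det R\<bar> ^ CARD('q)) * ennreal (1 / \<bar>det R\<bar> ^ CARD('q)) = 1"
    using dR by (subst ennreal_mult[symmetric]) simp_all
  ultimately show ?thesis by (simp add: ac_simps)
qed

section \<open>Finiteness of Gaussian smoothings of the prior\<close>

lemma nn_integral_lborel_affine:
  fixes f :: "'a::euclidean_space \<Rightarrow> ennreal"
  assumes [measurable]: "f \<in> borel_measurable borel" and s: "0 < s"
  shows "(\<integral>\<^sup>+x. f x \<partial>lborel) = ennreal (s ^ DIM('a)) * (\<integral>\<^sup>+x. f (t + s *\<^sub>R x) \<partial>lborel)"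
  by (subst lborel_affine[of s t])
     (use s in \<open>simp_all add: nn_integral_density nn_integral_distr nn_integral_cmult\<close>)

text \<open>The substitution \<open>M = Y + s1 Z\<close> turns the wide kernel into a smoothing at
  level \<open>s1\<close>, which is then compared with level \<open>s0\<close>. Level
  \<open>s0 = 0\<close> is allowed, as only \<open>s1\<close> is inverted.\<close>

lemma gauss_mix_gaussian_scaling:
  fixes Y :: "real^'p^'n"
  assumes card: "CARD('n) = CARD('p) + CARD('q::finite) + 1"
    and s: "0 \<le> s0" "s0 \<le> s1" "0 < s1"
  shows "(\<integral>\<^sup>+M. ennreal (exp (- (norm (M - Y))\<^sup>2 / (2 * s1\<^sup>2))) * gauss_mix TYPE('q) M \<partial>lborel)
    \<le> ennreal (s1 ^ DIM(real^'p^'n)) *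
       (\<integral>\<^sup>+Z. ennreal (exp (- (norm Z)\<^sup>2 / 2)) * gauss_mix TYPE('q) (Y + s0 *\<^sub>R Z) \<partial>lborel)"
proof -
  have "(\<integral>\<^sup>+M. ennreal (exp (- (norm (M - Y))\<^sup>2 / (2 * s1\<^sup>2))) * gauss_mix TYPE('q) M \<partial>lborel)
     = ennreal (s1 ^ DIM(real^'p^'n)) *
       (\<integral>\<^sup>+Z. ennreal (exp (- (norm Z)\<^sup>2 / 2)) * gauss_mix TYPE('q) (Y + s1 *\<^sub>R Z) \<partial>lborel)"
    by (subst nn_integral_lborel_affine[where s = s1 and t = Y])
       (use s in \<open>simp_all add: power_mult_distrib\<close>)
  also have "\<dots> \<le> ennreal (s1 ^ DIM(real^'p^'n)) *
       (\<integral>\<^sup>+Z. ennreal (exp (- (norm Z)\<^sup>2 / 2)) * gauss_mix TYPE('q) (Y + s0 *\<^sub>R Z) \<partial>lborel)"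
    by (intro mult_left_mono gauss_mix_smoothing_decreasing[OF card]) (use s in auto)
  finally show ?thesis .
qed

text \<open>Used to move the centre of a Gaussian at the cost of a constant factor and a doubled
  variance.\<close>

lemma norm_diff_sq_bound:
  fixes x y z :: "'a::real_inner"
  shows "(norm (x - z))\<^sup>2 / 4 \<le> (norm (x - y))\<^sup>2 / 2 + (norm (y - z))\<^sup>2 / 2"
proof -
  have "(norm (x - z))\<^sup>2 \<le> (norm (x - y) + norm (y - z))\<^sup>2"
    by (intro power_mono norm_diff_triangle_ineq[of x y y z, simplified] norm_ge_zero)
  also have "\<dots> \<le> 2 * (norm (x - y))\<^sup>2 + 2 * (norm (y - z))\<^sup>2"
    using sum_squares_bound[of "norm (x - y)" "norm (y - z)"] by (simp add: power2_sum)
  finally show ?thesis by simp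
qed

text \<open>Take \<open>Y0\<close> to be an isometric embedding, where the mixture has the finite
  value \<open>gauss_const\<close>. Recentring from \<open>Y\<close> to \<open>Y0\<close> doubles
  the variance, and the smoothing at \<open>Y0\<close> is bounded by its level 0, which involves the
  mixture at \<open>Y0\<close> alone.\<close>

lemma gauss_mix_gaussian_finite:
  fixes Y :: "real^'p^'n"
  assumes card: "CARD('n) = CARD('p) + CARD('q::finite) + 1"
  shows "(\<integral>\<^sup>+M. ennreal (exp (- (norm (M - Y))\<^sup>2 / 2)) * gauss_mix TYPE('q) M \<partial>lborel) < \<infinity>"
proof -
  have "dim (UNIV :: (real^'p) set) \<le> dim (UNIV :: (real^'n) set)"
    using card by simp
  then obtain f :: "real^'p \<Rightarrow> real^'n" where f: "linear f" "\<And>x. norm (f x) = norm x"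
    using isometry_subset_subspace[of "UNIV :: (real^'p) set" "UNIV :: (real^'n) set"] by (metis UNIV_I subspace_UNIV)
  define Y0 where "Y0 = matrix f"
  have "norm (Y0 *v x) = norm x" for x
    using fun_cong[OF matrix_vector_mul(2)[OF f(1)], of x] f(2) by (simp add: Y0_def)
  note g0 = gauss_mix_isometry[of Y0, OF this, where 'q = 'q]
  define C where "C = exp ((norm (Y - Y0))\<^sup>2 / 2)"
  have "(\<integral>\<^sup>+M. ennreal (exp (- (norm (M - Y))\<^sup>2 / 2)) * gauss_mix TYPE('q) M \<partial>lborel)
     \<le> (\<integral>\<^sup>+M. ennreal C * (ennreal (exp (- (norm (M - Y0))\<^sup>2 / (2 * (sqrt 2)\<^sup>2))) * gauss_mix TYPE('q) M) \<partial>lborel)"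
  proof (rule nn_integral_mono)
    fix M :: "real^'p^'n"
    have "exp (- (norm (M - Y))\<^sup>2 / 2) \<le> C * exp (- (norm (M - Y0))\<^sup>2 / (2 * (sqrt 2)\<^sup>2))"
      using norm_diff_sq_bound[of M Y0 Y] by (simp add: C_def exp_add[symmetric])
    then show "ennreal (exp (- (norm (M - Y))\<^sup>2 / 2)) * gauss_mix TYPE('q) M
      \<le> ennreal C * (ennreal (exp (- (norm (M - Y0))\<^sup>2 / (2 * (sqrt 2)\<^sup>2))) * gauss_mix TYPE('q) M)"
      unfolding mult.assoc[symmetric] by (intro mult_right_mono) (simp_all add: C_def ennreal_mult[symmetric])
  qed
  also have "\<dots> = ennreal C * (\<integral>\<^sup>+M. ennreal (exp (- (norm (M - Y0))\<^sup>2 / (2 * (sqrt 2)\<^sup>2))) * gauss_mix TYPE('q) M \<partial>lborel)"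
    by (rule nn_integral_cmult) measurable
  also have "\<dots> \<le> ennreal C * (ennreal (sqrt 2 ^ DIM(real^'p^'n)) *
       (\<integral>\<^sup>+Z. ennreal (exp (- (norm Z)\<^sup>2 / 2)) * gauss_mix TYPE('q) (Y0 + 0 *\<^sub>R Z) \<partial>lborel))"
    by (intro mult_left_mono gauss_mix_gaussian_scaling[OF card]) auto
  also have "\<dots> < \<infinity>"
    by (simp add: g0 nn_integral_multc nn_integral_gauss[simplified] ennreal_mult_less_top)
  finally show ?thesis .
qed

text \<open>The mixture is infinite at every rank-deficient matrix, but its Gaussian integral is
  finite; hence these matrices form a null set.\<close>

lemma AE_det_gram_pos:
  assumes card: "CARD('n) = CARD('p) + CARD('q::finite) + 1"
  shows "AE M in lborel. 0 < det (transpose M ** (M :: real^'p^'n))"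
proof -
  have "AE M in lborel. ennreal (exp (- (norm (M - 0))\<^sup>2 / 2)) * gauss_mix TYPE('q) (M :: real^'p^'n) \<noteq> \<infinity>"
    using gauss_mix_gaussian_finite[OF card, of 0]
    by (intro nn_integral_noteq_infinite) auto
  then show ?thesis
  proof (rule AE_mp, intro AE_I2 impI)
    fix M :: "real^'p^'n"
    assume "ennreal (exp (- (norm (M - 0))\<^sup>2 / 2)) * gauss_mix TYPE('q) M \<noteq> \<infinity>"
    then have "gauss_mix TYPE('q) M \<noteq> \<infinity>" by (auto simp: ennreal_mult_eq_top_iff)
    then have "det (transpose M ** M) \<noteq> 0" using gauss_mix_singular[of M, where 'q = 'q] by blast
    then show "0 < det (transpose M ** M)" using det_gram_nonneg[of M] by simp
  qed
qed

lemma pi_SVS_nonneg: "0 \<le> pi_SVS M" by (simp add: pi_SVS_def)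

lemma pi_SVS_measurable[measurable]: "pi_SVS \<in> borel_measurable borel"
proof -
  have "continuous_on UNIV (\<lambda>M::real^'p^'n. det (transpose M ** M))"
    unfolding det_def matrix_matrix_mult_def transpose_def by (simp, intro continuous_intros)
  then have [measurable]: "(\<lambda>M::real^'p^'n. det (transpose M ** M)) \<in> borel_measurable borel"
    by (rule borel_measurable_continuous_onI)
  show ?thesis
    unfolding pi_SVS_def[abs_def] by measurable
qed

lemma nn_integral_gauss_mix_eq_pi_SVS:
  fixes f :: "real^'p^'n \<Rightarrow> real"
  assumes card: "CARD('n) = CARD('p) + CARD('q::finite) + 1"
    and [measurable]: "f \<in> borel_measurable borel" and f: "\<And>M. 0 \<le> f M"
  shows "(\<integral>\<^sup>+M. ennreal (f M) * gauss_mix TYPE('q) M \<partial>lborel)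
    = ennreal (gauss_const TYPE('p) TYPE('q)) * (\<integral>\<^sup>+M. ennreal (f M * pi_SVS M) \<partial>lborel)"
proof -
  have "(\<integral>\<^sup>+M. ennreal (f M) * gauss_mix TYPE('q) M \<partial>lborel)
    = (\<integral>\<^sup>+M. ennreal (gauss_const TYPE('p) TYPE('q)) * ennreal (f M * pi_SVS M) \<partial>lborel)"
    by (rule nn_integral_cong_AE, rule AE_mp[OF AE_det_gram_pos[OF card]])
       (auto intro!: AE_I2 simp: gauss_mix_eq_pi_SVS[OF card] ennreal_mult f pi_SVS_nonneg ac_simps)
  then show ?thesis by (simp add: nn_integral_cmult)
qed

lemma pi_SVS_gaussian_integrable:
  fixes Y :: "real^'p^'n"
  assumes card: "CARD('n) = CARD('p) + CARD('q::finite) + 1"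
  shows "integrable lborel (\<lambda>M. exp (- (norm (M - Y))\<^sup>2 / 2) * pi_SVS M)"
proof (rule integrableI_nonneg)
  show "(\<integral>\<^sup>+M. ennreal (exp (- (norm (M - Y))\<^sup>2 / 2) * pi_SVS M) \<partial>lborel) < \<infinity>"
    using gauss_mix_gaussian_finite[OF card, of Y] gauss_const_pos[where 'p = 'p and 'q = 'q]
    by (subst (asm) nn_integral_gauss_mix_eq_pi_SVS[OF card]) (auto simp: ennreal_mult_less_top)
qed (auto simp: pi_SVS_nonneg)

text \<open>The monotonicity of smoothings from level 1 to level \<open>s\<close>, with the common
  factor \<open>gauss_const\<close> cancelled. It is the form of superharmonicity used for all
  posterior estimates.\<close>

lemma pi_SVS_gaussian_scaling:
  fixes Y :: "real^'p^'n"
  assumes card: "CARD('n) = CARD('p) + CARD('q::finite) + 1" and s: "1 \<le> s"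
  shows "integrable lborel (\<lambda>M. exp (- (norm (M - Y))\<^sup>2 / (2 * s\<^sup>2)) * pi_SVS M)"
    and "(\<integral>M. exp (- (norm (M - Y))\<^sup>2 / (2 * s\<^sup>2)) * pi_SVS M \<partial>lborel)
      \<le> s ^ DIM(real^'p^'n) * (\<integral>M. exp (- (norm (M - Y))\<^sup>2 / 2) * pi_SVS M \<partial>lborel)"
proof -
  let ?c = "ennreal (gauss_const TYPE('p) TYPE('q))"
  let ?I = "\<integral>M. exp (- (norm (M - Y))\<^sup>2 / 2) * pi_SVS M \<partial>lborel"
  have "(\<integral>\<^sup>+Z. ennreal (exp (- (norm Z)\<^sup>2 / 2)) * gauss_mix TYPE('q) (Y + 1 *\<^sub>R Z) \<partial>lborel)
     = (\<integral>\<^sup>+M. ennreal (exp (- (norm (M - Y))\<^sup>2 / 2)) * gauss_mix TYPE('q) M \<partial>lborel)"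
    by (subst (2) nn_integral_lborel_affine[where s = 1 and t = Y]) simp_all
  then have "?c * (\<integral>\<^sup>+M. ennreal (exp (- (norm (M - Y))\<^sup>2 / (2 * s\<^sup>2)) * pi_SVS M) \<partial>lborel)
    \<le> ennreal (s ^ DIM(real^'p^'n)) * (?c * (\<integral>\<^sup>+M. ennreal (exp (- (norm (M - Y))\<^sup>2 / 2) * pi_SVS M) \<partial>lborel))"
    using gauss_mix_gaussian_scaling[OF card, of 1 s Y] s
    by (simp add: nn_integral_gauss_mix_eq_pi_SVS[OF card])
  also have "\<dots> = ?c * ennreal (s ^ DIM(real^'p^'n) * ?I)"
    using s by (subst nn_integral_eq_integral[OF pi_SVS_gaussian_integrable[OF card]])
      (auto simp: pi_SVS_nonneg ennreal_mult ac_simps)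
  finally have le: "(\<integral>\<^sup>+M. ennreal (exp (- (norm (M - Y))\<^sup>2 / (2 * s\<^sup>2)) * pi_SVS M) \<partial>lborel)
    \<le> ennreal (s ^ DIM(real^'p^'n) * ?I)"
    using gauss_const_pos[where 'p = 'p and 'q = 'q] by (subst (asm) ennreal_mult_le_mult_iff) (auto)
  show int: "integrable lborel (\<lambda>M. exp (- (norm (M - Y))\<^sup>2 / (2 * s\<^sup>2)) * pi_SVS M)"
    by (rule integrableI_nonneg) (use le in \<open>auto simp: pi_SVS_nonneg intro: le_less_trans\<close>)
  show "(\<integral>M. exp (- (norm (M - Y))\<^sup>2 / (2 * s\<^sup>2)) * pi_SVS M \<partial>lborel) \<le> s ^ DIM(real^'p^'n) * ?I"
    using le s by (subst (asm) nn_integral_eq_integral[OF int])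
      (auto simp: pi_SVS_nonneg ennreal_le_iff mult_nonneg_nonneg Bochner_Integration.integral_nonneg)
qed

section \<open>Posterior moments\<close>

text \<open>The posterior density up to normalisation; the constant of the likelihood is dropped
  because it cancels in the posterior mean.\<close>

definition post_weight :: "real^'p^'n \<Rightarrow> real^'p^'n \<Rightarrow> real" where
  "post_weight Y M = exp (- (norm (M - Y))\<^sup>2 / 2) * pi_SVS M"

lemma post_weight_nonneg: "0 \<le> post_weight Y M"
  by (simp add: post_weight_def pi_SVS_nonneg)

lemma post_weight_measurable[measurable]:
  "(\<lambda>(Y, M). post_weight Y M) \<in> borel_measurable (borel \<Otimes>\<^sub>M borel)"
  unfolding post_weight_def by measurable

text \<open>The inequality \<open>r \<le> 4 * exp (r / 4)\<close> trades the second moment for a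
  doubled variance, and scaling by \<open>sqrt 2\<close> returns to the original one. The resulting
  factor does not depend on \<open>Y\<close>.\<close>

lemma post_weight_second_moment:
  fixes Y :: "real^'p^'n"
  assumes card: "CARD('n) = CARD('p) + CARD('q::finite) + 1"
  shows "integrable lborel (\<lambda>M. (norm (M - Y))\<^sup>2 * post_weight Y M)"
    and "(\<integral>M. (norm (M - Y))\<^sup>2 * post_weight Y M \<partial>lborel)
      \<le> 4 * sqrt 2 ^ DIM(real^'p^'n) * (\<integral>M. post_weight Y M \<partial>lborel)"
proof -
  note A = pi_SVS_gaussian_scaling[OF card, of "sqrt 2" Y, simplified real_sqrt_pow2[OF zero_le_numeral]]
  have le: "(norm (M - Y))\<^sup>2 * post_weight Y M \<le> 4 * (exp (- (norm (M - Y))\<^sup>2 / (2 * 2)) * pi_SVS M)" for M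
  proof -
    define r where "r = (norm (M - Y))\<^sup>2"
    have "r \<le> 4 * exp (r / 4)" using exp_ge_add_one_self[of "r / 4"] by linarith
    then have "r * exp (- r / 2) \<le> 4 * exp (r / 4) * exp (- r / 2)" by (intro mult_right_mono) auto
    also have "\<dots> = 4 * exp (- r / 4)" by (simp flip: exp_add)
    finally have "r * exp (- r / 2) * pi_SVS M \<le> 4 * exp (- r / 4) * pi_SVS M"
      by (intro mult_right_mono pi_SVS_nonneg)
    then show ?thesis by (simp add: post_weight_def r_def mult.assoc)
  qed
  show int: "integrable lborel (\<lambda>M. (norm (M - Y))\<^sup>2 * post_weight Y M)"
    by (rule Bochner_Integration.integrable_bound[OF integrable_mult_right[OF A(1), of 4]])
       (use le in \<open>auto simp: post_weight_nonneg pi_SVS_nonneg abs_mult\<close>)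
  have "(\<integral>M. (norm (M - Y))\<^sup>2 * post_weight Y M \<partial>lborel)
      \<le> (\<integral>M. 4 * (exp (- (norm (M - Y))\<^sup>2 / (2 * 2)) * pi_SVS M) \<partial>lborel)"
    by (rule integral_mono[OF int integrable_mult_right[OF A(1)] le]) simp
  also have "\<dots> \<le> 4 * (sqrt 2 ^ DIM(real^'p^'n) * (\<integral>M. post_weight Y M \<partial>lborel))"
    using A(2) by (simp add: post_weight_def)
  finally show "(\<integral>M. (norm (M - Y))\<^sup>2 * post_weight Y M \<partial>lborel)
      \<le> 4 * sqrt 2 ^ DIM(real^'p^'n) * (\<integral>M. post_weight Y M \<partial>lborel)" by simp
qed

lemma post_weight_integrable:
  fixes Y :: "real^'p^'n"
  assumes card: "CARD('n) = CARD('p) + CARD('q::finite) + 1"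
  shows "integrable lborel (post_weight Y)"
  using pi_SVS_gaussian_integrable[OF card, of Y] by (simp add: post_weight_def[abs_def])

lemma norm_le_one_plus_sq: "norm x \<le> 1 + (norm x)\<^sup>2"
  using sum_squares_bound[of 1 "norm x"] by (simp add: power2_eq_square) (smt (verit) norm_ge_zero zero_le_power2 power2_eq_square)

lemma post_weight_first_moment_integrable:
  fixes Y :: "real^'p^'n"
  assumes card: "CARD('n) = CARD('p) + CARD('q::finite) + 1"
  shows "integrable lborel (\<lambda>M. post_weight Y M *\<^sub>R (M - Y))"
proof (rule Bochner_Integration.integrable_bound)
  show "integrable lborel (\<lambda>M. post_weight Y M + (norm (M - Y))\<^sup>2 * post_weight Y M)"
    by (intro Bochner_Integration.integrable_add post_weight_integrable[OF card] post_weight_second_moment(1)[OF card])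
  show "AE M in lborel. norm (post_weight Y M *\<^sub>R (M - Y)) \<le> norm (post_weight Y M + (norm (M - Y))\<^sup>2 * post_weight Y M)"
  proof (rule AE_I2)
    fix M
    have "post_weight Y M * norm (M - Y) \<le> post_weight Y M * (1 + (norm (M - Y))\<^sup>2)"
      by (intro mult_left_mono norm_le_one_plus_sq post_weight_nonneg)
    then show "norm (post_weight Y M *\<^sub>R (M - Y)) \<le> norm (post_weight Y M + (norm (M - Y))\<^sup>2 * post_weight Y M)"
      using post_weight_nonneg[of Y M] by (simp add: distrib_left mult.commute)
  qed
qed measurable

lemma post_weight_integral_pos:
  fixes Y :: "real^'p^'n"
  assumes card: "CARD('n) = CARD('p) + CARD('q::finite) + 1"
  shows "0 < (\<integral>M. post_weight Y M \<partial>lborel)"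
proof (rule integral_lborel_pos[OF post_weight_integrable[OF card]])
  show "AE M in lborel. 0 < post_weight Y M"
    using AE_det_gram_pos[OF card] by eventually_elim (simp add: post_weight_def pi_SVS_def)
qed

section \<open>Homogeneity of the prior and the radial posterior moment\<close>

lemma pi_SVS_scaleR:
  fixes M :: "real^'p^'n"
  assumes card: "CARD('n) = CARD('p) + CARD('q::finite) + 1" and t: "0 < t"
  shows "t ^ (CARD('p) * CARD('q)) * pi_SVS (t *\<^sub>R M) = pi_SVS M"
proof -
  let ?T = "matrix ((*\<^sub>R) t) :: real^'p^'p"
  have "t *\<^sub>R M = M ** ?T"
    unfolding matrix_eq matrix_vector_mul_assoc[symmetric]
    by (simp add: matrix_vector_mult_scaleR scaleR_matrix_vector_assoc)
  then have "det (transpose (t *\<^sub>R M) ** (t *\<^sub>R M)) = t ^ (2 * CARD('p)) * det (transpose M ** M)"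
    by (simp add: matrix_transpose_mul matrix_mul_assoc[symmetric] det_mul)
       (simp add: matrix_mul_assoc det_mul power_mult power2_eq_square power_mult_distrib)
  moreover have "(t ^ (2 * CARD('p))) powr (- (real CARD('q)) / 2) = 1 / t ^ (CARD('p) * CARD('q))"
    using t by (simp add: powr_realpow[symmetric] powr_powr powr_minus_divide)
  ultimately show ?thesis
    using card t by (simp add: pi_SVS_def powr_mult det_gram_nonneg)
qed

text \<open>Rescaling \<open>M\<close> by \<open>t\<close> and homogeneity turn the left side into
  \<open>t ^ N\<close> times a smoothing at \<open>Y\<close> of level \<open>1 / t\<close>, with N
  the dimension. Superharmonicity bounds that smoothing by \<open>(1 / t) ^ N\<close> times the
  right side.\<close>

lemma post_weight_shrink:
  fixes Y :: "real^'p^'n"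
  assumes card: "CARD('n) = CARD('p) + CARD('q::finite) + 1" and t: "0 < t" "t \<le> 1"
  shows "t ^ (CARD('p) * CARD('q)) * (\<integral>M. post_weight (t *\<^sub>R Y) M \<partial>lborel) \<le> (\<integral>M. post_weight Y M \<partial>lborel)"
proof -
  define k where "k = CARD('p) * CARD('q)"
  define N where "N = DIM(real^'p^'n)"
  let ?f = "\<lambda>M. exp (- (norm (M - Y))\<^sup>2 / (2 * (1 / t)\<^sup>2)) * pi_SVS M"
  note A = pi_SVS_gaussian_scaling[OF card, of "1 / t" Y]
  have eq: "t ^ k * post_weight (t *\<^sub>R Y) (0 + t *\<^sub>R M) = ?f M" for M
  proof -
    have "- (norm (0 + t *\<^sub>R M - t *\<^sub>R Y))\<^sup>2 / 2 = - (norm (M - Y))\<^sup>2 / (2 * (1 / t)\<^sup>2)"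
      using t by (simp add: scaleR_diff_right[symmetric] power_mult_distrib power_divide)
    then show ?thesis
      unfolding post_weight_def k_def
      by (simp only: pi_SVS_scaleR[OF card t(1), of M, symmetric] mult.left_commute add_0)
  qed
  have "ennreal (t ^ k * (\<integral>M. post_weight (t *\<^sub>R Y) M \<partial>lborel))
      = ennreal (t ^ k) * (\<integral>\<^sup>+M. ennreal (post_weight (t *\<^sub>R Y) M) \<partial>lborel)"
    using t by (subst nn_integral_eq_integral[OF post_weight_integrable[OF card]])
      (auto simp: post_weight_nonneg ennreal_mult)
  also have "\<dots> = ennreal (t ^ N) * (\<integral>\<^sup>+M. ennreal (?f M) \<partial>lborel)"
    unfolding eq[symmetric] N_def
    by (subst nn_integral_lborel_affine[OF _ t(1), of _ 0])
       (use t in \<open>simp_all add: post_weight_nonneg ennreal_mult nn_integral_cmult ac_simps\<close>)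
  also have "\<dots> = ennreal (t ^ N * (\<integral>M. ?f M \<partial>lborel))"
    using t A(1) by (subst nn_integral_eq_integral) (auto simp: pi_SVS_nonneg ennreal_mult)
  finally have "t ^ k * (\<integral>M. post_weight (t *\<^sub>R Y) M \<partial>lborel) = t ^ N * (\<integral>M. ?f M \<partial>lborel)"
    using t by (subst (asm) ennreal_inj) (auto simp: post_weight_nonneg pi_SVS_nonneg)
  also have "\<dots> \<le> t ^ N * ((1 / t) ^ N * (\<integral>M. post_weight Y M \<partial>lborel))"
    using A(2) t by (intro mult_left_mono) (auto simp: N_def post_weight_def)
  also have "\<dots> = (\<integral>M. post_weight Y M \<partial>lborel)"
    using t by (simp add: power_divide)
  finally show ?thesis by (simp add: k_def)
qed

text \<open>The bound \<open>1 + x \<le> exp x\<close> on the shifted weight replaces differentiation under the integral.\<close>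

lemma post_weight_radial_moment:
  fixes Y :: "real^'p^'n"
  assumes card: "CARD('n) = CARD('p) + CARD('q::finite) + 1"
  shows "- real (CARD('p) * CARD('q)) * (\<integral>M. post_weight Y M \<partial>lborel)
     \<le> Y \<bullet> (\<integral>M. post_weight Y M *\<^sub>R (M - Y) \<partial>lborel)"
proof -
  define k where "k = CARD('p) * CARD('q)"
  define m where "m = (\<integral>M. post_weight Y M \<partial>lborel)"
  define B where "B = (\<integral>M. (Y \<bullet> (M - Y)) * post_weight Y M \<partial>lborel)"
  have m: "0 \<le> m" by (simp add: m_def post_weight_nonneg)
  have iB: "integrable lborel (\<lambda>M. (Y \<bullet> (M - Y)) * post_weight Y M)"
    using integrable_inner_right[of Y, OF post_weight_first_moment_integrable[OF card, of Y]]
    by (simp add: ac_simps)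
  have BY: "Y \<bullet> (\<integral>M. post_weight Y M *\<^sub>R (M - Y) \<partial>lborel) = B"
    using integral_inner_right[of Y lborel, OF post_weight_first_moment_integrable[OF card, of Y]]
    by (simp add: B_def ac_simps)
  \<comment> \<open>Compare \<open>Y\<close> with \<open>(1 - h) *\<^sub>R Y\<close>:
    \<open>post_weight_shrink\<close> bounds the mass there, and Bernoulli's inequality linearises
    \<open>(1 - h) ^ k\<close>. After division by \<open>h\<close> the bound tends to
    \<open>k * m\<close> as \<open>h\<close> decreases to 0.\<close>
  have step: "- B \<le> m * (real k / (1 - real k * h)) + h * (norm Y)\<^sup>2 / 2 * m" if h: "0 < h" "h < 1" "real k * h < 1" for h
  proof -
    have pw: "(1 - h * (Y \<bullet> (M - Y)) - h\<^sup>2 * (norm Y)\<^sup>2 / 2) * post_weight Y M \<le> post_weight ((1 - h) *\<^sub>R Y) M" for M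
    proof -
      have e: "- (norm (M - (1 - h) *\<^sub>R Y))\<^sup>2 / 2 = (- h * (Y \<bullet> (M - Y)) - h\<^sup>2 * (norm Y)\<^sup>2 / 2) + (- (norm (M - Y))\<^sup>2 / 2)"
        unfolding power2_norm_eq_inner
        by (simp add: inner_diff_left inner_diff_right inner_commute power2_eq_square algebra_simps) (simp add: field_simps)
      have eq: "post_weight ((1 - h) *\<^sub>R Y) M = exp (- h * (Y \<bullet> (M - Y)) - h\<^sup>2 * (norm Y)\<^sup>2 / 2) * post_weight Y M"
        unfolding post_weight_def e exp_add by simp
      show ?thesis
        unfolding eq using exp_ge_add_one_self[of "- h * (Y \<bullet> (M - Y)) - h\<^sup>2 * (norm Y)\<^sup>2 / 2"]
        by (intro mult_right_mono post_weight_nonneg) linarith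
    qed
    have "m - h * B - h\<^sup>2 * (norm Y)\<^sup>2 / 2 * m
        = (\<integral>M. (1 - h * (Y \<bullet> (M - Y)) - h\<^sup>2 * (norm Y)\<^sup>2 / 2) * post_weight Y M \<partial>lborel)"
    proof -
      have "(\<integral>M. post_weight Y M - h * ((Y \<bullet> (M - Y)) * post_weight Y M) - h\<^sup>2 * (norm Y)\<^sup>2 / 2 * post_weight Y M \<partial>lborel)
          = m - h * B - h\<^sup>2 * (norm Y)\<^sup>2 / 2 * m"
        using iB post_weight_integrable[OF card, of Y]
        by (simp add: m_def B_def)
      then show ?thesis by (simp add: left_diff_distrib mult.assoc)
    qed
    also have "\<dots> \<le> (\<integral>M. post_weight ((1 - h) *\<^sub>R Y) M \<partial>lborel)"
    proof (rule integral_mono[OF _ post_weight_integrable[OF card] pw])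
      have "integrable lborel (\<lambda>M. post_weight Y M - h * ((Y \<bullet> (M - Y)) * post_weight Y M) - h\<^sup>2 * (norm Y)\<^sup>2 / 2 * post_weight Y M)"
        using iB post_weight_integrable[OF card, of Y] by simp
      then show "integrable lborel (\<lambda>M. (1 - h * (Y \<bullet> (M - Y)) - h\<^sup>2 * (norm Y)\<^sup>2 / 2) * post_weight Y M)"
        by (simp add: left_diff_distrib mult.assoc)
    qed
    also have "\<dots> \<le> m / (1 - real k * h)"
    proof -
      let ?J = "\<integral>M. post_weight ((1 - h) *\<^sub>R Y) M \<partial>lborel"
      have "1 - real k * h \<le> (1 - h) ^ k"
        using Bernoulli_inequality[of "- h" k] h by simp
      moreover have "0 \<le> ?J" by (simp add: post_weight_nonneg)
      ultimately have "(1 - real k * h) * ?J \<le> (1 - h) ^ k * ?J" by (intro mult_right_mono)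
      also have "\<dots> \<le> m"
        using post_weight_shrink[OF card, of "1 - h" Y] h by (simp add: k_def m_def)
      finally show ?thesis using h by (simp add: field_simps)
    qed
    finally have "h * (- B) \<le> m / (1 - real k * h) - m + h\<^sup>2 * (norm Y)\<^sup>2 / 2 * m" by simp
    also have "\<dots> = h * (m * (real k / (1 - real k * h)) + h * (norm Y)\<^sup>2 / 2 * m)"
      using h by (simp add: field_simps power2_eq_square)
    finally show ?thesis using h(1) by (simp only: mult_le_cancel_left_pos)
  qed
  have "((\<lambda>h. m * (real k / (1 - real k * h)) + h * (norm Y)\<^sup>2 / 2 * m) \<longlongrightarrow>
     m * (real k / (1 - real k * 0)) + 0 * (norm Y)\<^sup>2 / 2 * m) (at_right 0)"
    by (intro tendsto_intros) auto
  moreover have "eventually (\<lambda>h. - B \<le> m * (real k / (1 - real k * h)) + h * (norm Y)\<^sup>2 / 2 * m) (at_right 0)"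
  proof -
    have "eventually (\<lambda>h. h \<in> {0<..<1 / (real k + 1)}) (at_right 0)"
      by (rule eventually_at_right_real) simp
    \<comment> \<open>The endpoint \<open>1 / (k + 1)\<close> ensures both \<open>h < 1\<close> and
      \<open>k * h < 1\<close>.\<close>
    then show ?thesis
    proof eventually_elim
      case (elim h)
      then have "0 < h" "h * (real k + 1) < 1" by (simp_all add: field_simps)
      moreover have "0 \<le> h * real k" using elim by simp
      moreover have "h * (real k + 1) = h * real k + h" by (simp add: algebra_simps)
      ultimately have "h < 1" "h * real k < 1" by linarith+
      then show ?case using step[of h] elim by (simp add: mult.commute)
    qed
  qed
  ultimately have "- B \<le> m * (real k / (1 - real k * 0)) + 0 * (norm Y)\<^sup>2 / 2 * m"
    by (rule tendsto_lowerbound) simp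
  then show ?thesis unfolding BY by (simp add: k_def m_def mult.commute)
qed

section \<open>Domination\<close>

lemma frob_sq_eq_norm: "frob_sq A = (norm A)\<^sup>2"
  by (simp add: frob_sq_def norm_matrix_sq)

definition gauss_norm_const :: "'p::finite itself \<Rightarrow> 'n::finite itself \<Rightarrow> real" where
  "gauss_norm_const _ _ = (2 * pi) powr (- (real CARD('n) * real CARD('p)) / 2)"

lemma gauss_norm_const_pos: "0 < gauss_norm_const TYPE('p::finite) TYPE('n::finite)"
  by (simp add: gauss_norm_const_def)

lemma gauss_dens_eq:
  "gauss_dens M (Y :: real^'p^'n) = gauss_norm_const TYPE('p) TYPE('n) * exp (- (norm (Y - M))\<^sup>2 / 2)"
  by (simp add: gauss_dens_def gauss_norm_const_def frob_sq_eq_norm)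

text \<open>Tweedie's formula in moment form: the normalised first moment of \<open>M - Y\<close>
  stands for the gradient of the logarithm of the marginal.\<close>

lemma M_SVS_eq:
  fixes Y :: "real^'p^'n"
  assumes card: "CARD('n) = CARD('p) + CARD('q::finite) + 1"
  shows "M_SVS Y = Y + (1 / (\<integral>M. post_weight Y M \<partial>lborel)) *\<^sub>R (\<integral>M. post_weight Y M *\<^sub>R (M - Y) \<partial>lborel)"
proof -
  let ?c = "gauss_norm_const TYPE('p) TYPE('n)"
  let ?m = "\<integral>M. post_weight Y M \<partial>lborel"
  have w: "gauss_dens M Y * pi_SVS M = ?c * post_weight Y M" for M
    by (simp add: gauss_dens_eq post_weight_def norm_minus_commute)
  have "(\<integral>M. (?c * post_weight Y M) *\<^sub>R M \<partial>lborel)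
     = (\<integral>M. ?c *\<^sub>R (post_weight Y M *\<^sub>R (M - Y) + post_weight Y M *\<^sub>R Y) \<partial>lborel)"
    by (simp add: scaleR_diff_right)
  also have "\<dots> = ?c *\<^sub>R ((\<integral>M. post_weight Y M *\<^sub>R (M - Y) \<partial>lborel) + ?m *\<^sub>R Y)"
    using post_weight_first_moment_integrable[OF card, of Y] post_weight_integrable[OF card, of Y]
    by (subst integral_scaleR_right, subst Bochner_Integration.integral_add) simp_all
  finally show ?thesis
    using gauss_norm_const_pos[where 'p = 'p and 'n = 'n] post_weight_integral_pos[OF card, of Y]
    by (simp add: M_SVS_def gen_bayes_def marginal_def w scaleR_add_right)
qed

lemma M_SVS_measurable:
  assumes card: "CARD('n) = CARD('p) + CARD('q::finite) + 1"
  shows "M_SVS \<in> borel_measurable (borel :: (real^'p^'n) measure)"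
proof -
  have "M_SVS = (\<lambda>Y::real^'p^'n. Y + (1 / (\<integral>M. post_weight Y M \<partial>lborel)) *\<^sub>R (\<integral>M. post_weight Y M *\<^sub>R (M - Y) \<partial>lborel))"
    by (rule ext) (rule M_SVS_eq[OF card])
  also have "\<dots> \<in> borel_measurable borel" by measurable
  finally show ?thesis .
qed

text \<open>The first moment is at most the mass plus the second moment, and the latter is a
  constant multiple of the mass, uniformly in \<open>Y\<close>. Boundedness gives
  \<open>M_SVS\<close> polynomial growth and hence finite risk.\<close>

lemma M_SVS_diff_bounded:
  assumes card: "CARD('n) = CARD('p) + CARD('q::finite) + 1"
  obtains C where "\<And>Y :: real^'p^'n. norm (M_SVS Y - Y) \<le> C"
proof
  fix Y :: "real^'p^'n"
  let ?m = "\<integral>M. post_weight Y M \<partial>lborel"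
  have m: "0 < ?m" by (rule post_weight_integral_pos[OF card])
  have "norm (\<integral>M. post_weight Y M *\<^sub>R (M - Y) \<partial>lborel) \<le> (\<integral>M. norm (post_weight Y M *\<^sub>R (M - Y)) \<partial>lborel)"
    by (rule integral_norm_bound)
  also have "\<dots> \<le> (\<integral>M. post_weight Y M + (norm (M - Y))\<^sup>2 * post_weight Y M \<partial>lborel)"
  proof (rule integral_mono[OF integrable_norm[OF post_weight_first_moment_integrable[OF card]]])
    show "integrable lborel (\<lambda>M. post_weight Y M + (norm (M - Y))\<^sup>2 * post_weight Y M)"
      by (intro Bochner_Integration.integrable_add post_weight_integrable[OF card] post_weight_second_moment(1)[OF card])
    fix M :: "real^'p^'n"
    have "post_weight Y M * norm (M - Y) \<le> post_weight Y M * (1 + (norm (M - Y))\<^sup>2)"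
      by (intro mult_left_mono norm_le_one_plus_sq post_weight_nonneg)
    then show "norm (post_weight Y M *\<^sub>R (M - Y)) \<le> post_weight Y M + (norm (M - Y))\<^sup>2 * post_weight Y M"
      using post_weight_nonneg[of Y M] by (simp add: distrib_left mult.commute)
  qed
  also have "\<dots> = ?m + (\<integral>M. (norm (M - Y))\<^sup>2 * post_weight Y M \<partial>lborel)"
    by (intro Bochner_Integration.integral_add post_weight_integrable[OF card] post_weight_second_moment(1)[OF card])
  also have "\<dots> \<le> (1 + 4 * sqrt 2 ^ DIM(real^'p^'n)) * ?m"
    using post_weight_second_moment(2)[OF card, of Y] by (simp add: distrib_right)
  finally show "norm (M_SVS Y - Y) \<le> 1 + 4 * sqrt 2 ^ DIM(real^'p^'n)"
    using m by (simp add: M_SVS_eq[OF card] field_simps)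
qed

lemma M_SVS_radial_bound:
  fixes Y :: "real^'p^'n"
  assumes card: "CARD('n) = CARD('p) + CARD('q::finite) + 1"
  shows "- real (CARD('p) * CARD('q)) \<le> Y \<bullet> (M_SVS Y - Y)"
  using post_weight_radial_moment[OF card, of Y] post_weight_integral_pos[OF card, of Y]
  by (simp add: M_SVS_eq[OF card] pos_le_divide_eq)

section \<open>Stein's identity and the comparison of risks\<close>

lemma gaussian_shift_bound:
  fixes y \<theta> :: "'a::real_inner"
  shows "\<bar>exp (- (norm (y - \<theta>))\<^sup>2 / 2)\<bar> \<le> exp ((norm \<theta>)\<^sup>2 / 2) * exp (- (1/4) * (norm y)\<^sup>2)"
  using norm_diff_sq_bound[of y 0 \<theta>] by (simp flip: exp_add)

text \<open>Integration by parts for the field \<open>u y *\<^sub>R y\<close>, summed over the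
  basis; the factor of \<open>G y\<close> on the right is its divergence.\<close>

lemma stein_identity_shrinkage:
  fixes \<theta> :: "'a::euclidean_space"
  defines "G \<equiv> \<lambda>y. exp (- (norm (y - \<theta>))\<^sup>2 / 2)" and "u \<equiv> \<lambda>y. 1 / (1 + (norm y)\<^sup>2)"
  shows "(\<integral>y. u y * (y \<bullet> (y - \<theta>)) * G y \<partial>lborel)
    = (\<integral>y. (real DIM('a) * u y - 2 * (u y * u y) * (y \<bullet> y)) * G y \<partial>lborel)"
proof -
  have pos: "0 < 1 + (norm y)\<^sup>2" for y :: 'a by (simp add: add_pos_nonneg)
  have ne: "1 + (norm y)\<^sup>2 \<noteq> 0" for y :: 'a using pos[of y] by simp
  have uc: "continuous_on UNIV u" unfolding u_def by (intro continuous_intros) (use ne in auto)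
  have Gc: "continuous_on UNIV G" unfolding G_def by (intro continuous_intros) auto
  have pu: "poly_growth u"
    by (rule poly_growthI[where C = 1 and k = 0]) (simp add: u_def pos abs_of_pos)
  have int: "integrable lborel (\<lambda>y. f y * G y)" if "poly_growth f" "continuous_on UNIV f" for f
    unfolding G_def
    by (rule integrable_poly_growth_gaussian[OF that(1) _ _ gaussian_shift_bound])
       (use that Gc in \<open>auto intro!: borel_measurable_continuous_onI continuous_intros simp: G_def\<close>)
  define D where "D = (\<lambda>b y. u y * (b \<bullet> b) - 2 * (u y * u y) * ((y \<bullet> b) * (y \<bullet> b)) - u y * ((y \<bullet> b) * ((y - \<theta>) \<bullet> b)))"
  have D: "integrable lborel (\<lambda>y. D b y * G y) \<and> (\<integral>y. D b y * G y \<partial>lborel) = 0" for b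
  proof
    show i: "integrable lborel (\<lambda>y. D b y * G y)"
      unfolding D_def by (rule int) (intro poly_growth_intros pu, intro continuous_intros uc)
    show "(\<integral>y. D b y * G y \<partial>lborel) = 0"
    proof (rule integral_directional_derivative_eq_0[where b = b and f = "\<lambda>y. (u y * (y \<bullet> b)) * G y"])
      show "((\<lambda>t. u (y + t *\<^sub>R b) * ((y + t *\<^sub>R b) \<bullet> b) * G (y + t *\<^sub>R b)) has_real_derivative D b y * G y) (at 0)" for y
      proof -
        have 1: "((\<lambda>t. (norm (y + t *\<^sub>R b - \<theta>))\<^sup>2) has_real_derivative 2 * ((y - \<theta>) \<bullet> b)) (at 0)"
          using DERIV_norm_sq_line[of "y - \<theta>" b] by (simp add: algebra_simps)
        have 2: "((\<lambda>t. 1 + (norm (y + t *\<^sub>R b))\<^sup>2) has_real_derivative 0 + 2 * (y \<bullet> b)) (at 0)"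
          by (intro DERIV_add DERIV_const DERIV_norm_sq_line)
        have 3: "((\<lambda>t. (y + t *\<^sub>R b) \<bullet> b) has_real_derivative b \<bullet> b) (at 0)"
          by (auto intro!: derivative_eq_intros simp: inner_add_left)
        have 4: "((\<lambda>t. u (y + t *\<^sub>R b) * ((y + t *\<^sub>R b) \<bullet> b)) has_real_derivative
            u y * (b \<bullet> b) - 2 * (u y * u y) * ((y \<bullet> b) * (y \<bullet> b))) (at 0)"
          unfolding u_def
          by (rule DERIV_cong[OF DERIV_mult[OF DERIV_divide[OF DERIV_const[of 1] 2] 3]])
             (use ne[of y] in \<open>simp_all add: power2_eq_square\<close>)
        show ?thesis
          unfolding G_def
          by (rule DERIV_cong[OF DERIV_mult_exp_half[OF 4 1]]) (simp add: D_def field_simps)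
      qed
      show "integrable lborel (\<lambda>y. (u y * (y \<bullet> b)) * G y)"
        by (rule int) (intro poly_growth_intros pu, intro continuous_intros uc)
    qed (use i in \<open>auto simp: D_def intro!: borel_measurable_continuous_onI continuous_intros uc Gc\<close>)
  qed
  have "(\<Sum>b\<in>Basis. D b y) = real DIM('a) * u y - 2 * (u y * u y) * (y \<bullet> y) - u y * (y \<bullet> (y - \<theta>))" for y
    by (simp add: D_def sum_subtractf sum_Basis_inner_mult flip: sum_distrib_left)
  then have "(\<Sum>b\<in>Basis. D b y * G y) = (real DIM('a) * u y - 2 * (u y * u y) * (y \<bullet> y)) * G y - u y * (y \<bullet> (y - \<theta>)) * G y" for y
    unfolding sum_distrib_right[symmetric] by (simp add: left_diff_distrib)
  moreover have "(\<integral>y. (\<Sum>b\<in>Basis. D b y * G y) \<partial>lborel) = 0"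
    using D by (simp add: Bochner_Integration.integral_sum)
  moreover have "integrable lborel (\<lambda>y. (real DIM('a) * u y - 2 * (u y * u y) * (y \<bullet> y)) * G y)"
       "integrable lborel (\<lambda>y. u y * (y \<bullet> (y - \<theta>)) * G y)"
    by (rule int; (intro poly_growth_intros pu | intro continuous_intros uc))+
  ultimately show ?thesis by simp
qed

text \<open>The radial bound controls the cross term with \<open>M_SVS Y - Y\<close>, and Stein's
  identity evaluates the one with \<open>Y - \<theta>\<close>. The gain is strict at every
  \<theta>.\<close>

lemma risk_strict_improvement:
  fixes \<theta> :: "real^'p^'n"
  assumes card: "CARD('n) = CARD('p) + CARD('q::finite) + 1" and p: "2 \<le> CARD('p)"
  shows "frob_risk (\<lambda>Y. M_SVS Y - (1 / (1 + (norm Y)\<^sup>2)) *\<^sub>R Y) \<theta> < frob_risk M_SVS \<theta>"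
proof -
  let ?c = "gauss_norm_const TYPE('p) TYPE('n)"
  define G where "G = (\<lambda>Y. exp (- (norm (Y - \<theta>))\<^sup>2 / 2))"
  define u where "u = (\<lambda>Y::real^'p^'n. 1 / (1 + (norm Y)\<^sup>2))"
  define d where "d = (\<lambda>Y. M_SVS Y - u Y *\<^sub>R Y)"
  have u: "0 < u Y" "u Y \<le> 1" for Y by (simp_all add: u_def add_pos_nonneg)
  have uY: "u Y * (norm Y)\<^sup>2 \<le> 1" for Y by (simp add: u_def add_pos_nonneg)
  have G0: "0 \<le> G Y" for Y by (simp add: G_def)
  note [measurable] = M_SVS_measurable[OF card]
  have um[measurable]: "u \<in> borel_measurable borel" unfolding u_def by measurable
  have Gm[measurable]: "G \<in> borel_measurable borel" unfolding G_def by measurable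
  obtain C where C: "\<And>Y :: real^'p^'n. norm (M_SVS Y - Y) \<le> C" using M_SVS_diff_bounded[OF card] by blast
  have int: "integrable lborel (\<lambda>Y. f Y * G Y)" if "poly_growth f" "f \<in> borel_measurable borel" for f
    unfolding G_def
    by (rule integrable_poly_growth_gaussian[OF that(1) _ _ gaussian_shift_bound]) (use that in simp_all)
  have pe: "poly_growth (\<lambda>Y::real^'p^'n. M_SVS Y - Y)"
    by (rule poly_growthI[where C = C and k = 0]) (simp add: C)
  have pM: "poly_growth (\<lambda>Y::real^'p^'n. M_SVS Y)"
    using poly_growth_add[OF pe poly_growth_id] by simp
  have pu: "poly_growth u"
    by (rule poly_growthI[where C = 1 and k = 0]) (use u in \<open>simp add: less_imp_le\<close>)
  note growth = poly_growth_intros pe pM pu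
  \<comment> \<open>Polynomial growth makes the risk finite, so that estimators can be compared
    through real integrals.\<close>
  have risk: "frob_risk t \<theta> = ennreal (?c * (\<integral>Y. (norm (t Y - \<theta>))\<^sup>2 * G Y \<partial>lborel)) \<and> integrable lborel (\<lambda>Y. (norm (t Y - \<theta>))\<^sup>2 * G Y)"
    if pt: "poly_growth t" and [measurable]: "t \<in> borel_measurable borel" for t
  proof
    show i: "integrable lborel (\<lambda>Y. (norm (t Y - \<theta>))\<^sup>2 * G Y)"
      unfolding power2_norm_eq_inner by (rule int) (intro growth pt, measurable)
    have "frob_risk t \<theta> = (\<integral>\<^sup>+Y. ennreal (?c * ((norm (t Y - \<theta>))\<^sup>2 * G Y)) \<partial>lborel)"
      by (simp add: frob_risk_def frob_sq_eq_norm gauss_dens_eq G_def ac_simps)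
    also have "\<dots> = ennreal (\<integral>Y. ?c * ((norm (t Y - \<theta>))\<^sup>2 * G Y) \<partial>lborel)"
      using i gauss_norm_const_pos[where 'p = 'p and 'n = 'n]
      by (intro nn_integral_eq_integral) (auto simp: G0 less_imp_le)
    finally show "frob_risk t \<theta> = ennreal (?c * (\<integral>Y. (norm (t Y - \<theta>))\<^sup>2 * G Y \<partial>lborel))" by simp
  qed
  have pd: "poly_growth d" unfolding d_def by (intro growth)
  have dm: "d \<in> borel_measurable borel" unfolding d_def by measurable
  define k where "k = real (CARD('p) * CARD('q))"
  define N where "N = real DIM(real^'p^'n)"
  have Nk: "N - k \<ge> 6"
  proof -
    have "CARD('p) * (CARD('p) + 1) \<ge> 2 * 3" by (rule mult_le_mono) (use p in auto)
    then have "real (CARD('p) * (CARD('p) + 1)) \<ge> 6" by linarith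
    moreover have "N - k = real (CARD('p) * (CARD('p) + 1))"
      using card by (simp add: N_def k_def algebra_simps)
    ultimately show ?thesis by simp
  qed
  have iu: "integrable lborel (\<lambda>Y. u Y * G Y)" by (rule int) (intro growth, measurable)
  define S where "S = (\<lambda>Y. u Y * (Y \<bullet> (Y - \<theta>)))"
  define D where "D = (\<lambda>Y::real^'p^'n. N * u Y - 2 * (norm Y)\<^sup>2 * (u Y * u Y))"
  have iS: "integrable lborel (\<lambda>Y. S Y * G Y)" unfolding S_def by (rule int) (intro growth, measurable)
  have iD: "integrable lborel (\<lambda>Y. D Y * G Y)"
    unfolding D_def power2_norm_eq_inner by (rule int) (intro growth, measurable)
  have SD: "(\<integral>Y. S Y * G Y \<partial>lborel) = (\<integral>Y. D Y * G Y \<partial>lborel)"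
    using stein_identity_shrinkage[of \<theta>]
    by (simp add: S_def D_def G_def u_def N_def ac_simps flip: power2_norm_eq_inner)
  \<comment> \<open>Expand the square after writing \<open>M_SVS Y - \<theta>\<close> as
    \<open>(M_SVS Y - Y) + (Y - \<theta>)\<close> in the cross term. The quadratic term is at most
    \<open>u Y\<close>, the first cross term at most \<open>2 * k * u Y\<close>, and the second is
    kept as \<open>S\<close> for Stein's identity.\<close>
  have pw: "(norm (d Y - \<theta>))\<^sup>2 * G Y \<le> (norm (M_SVS Y - \<theta>))\<^sup>2 * G Y + (1 + 2 * k) * (u Y * G Y) - 2 * (S Y * G Y)" for Y
  proof -
    have "(norm (d Y - \<theta>))\<^sup>2 = (norm (M_SVS Y - \<theta>))\<^sup>2 + u Y * u Y * (norm Y)\<^sup>2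
        - 2 * u Y * (Y \<bullet> (M_SVS Y - Y)) - 2 * S Y"
      unfolding power2_norm_eq_inner d_def S_def
      by (simp add: inner_diff_left inner_diff_right inner_commute algebra_simps)
    also have "\<dots> \<le> (norm (M_SVS Y - \<theta>))\<^sup>2 + u Y * 1 - 2 * u Y * (- k) - 2 * S Y"
    proof -
      have "u Y * (u Y * (norm Y)\<^sup>2) \<le> u Y * 1" using u[of Y] by (intro mult_left_mono uY) simp
      moreover have "2 * u Y * (- k) \<le> 2 * u Y * (Y \<bullet> (M_SVS Y - Y))"
        using u[of Y] M_SVS_radial_bound[OF card, of Y] by (intro mult_left_mono) (simp_all add: k_def)
      ultimately show ?thesis by (simp add: mult.assoc mult.commute[of k])
    qed
    finally have "(norm (d Y - \<theta>))\<^sup>2 * G Y \<le> ((norm (M_SVS Y - \<theta>))\<^sup>2 + u Y * 1 - 2 * u Y * (- k) - 2 * S Y) * G Y"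
      by (rule mult_right_mono[OF _ G0])
    then show ?thesis by (simp add: algebra_simps)
  qed
  have Dlow: "(N - 2) * (u Y * G Y) \<le> D Y * G Y" for Y
  proof -
    have "u Y * (norm Y)\<^sup>2 * u Y \<le> 1 * u Y" using uY[of Y] u[of Y] by (intro mult_right_mono) auto
    then have "(N - 2) * u Y \<le> D Y" by (simp add: D_def algebra_simps)
    from mult_right_mono[OF this G0[of Y]] show ?thesis by (simp add: mult.assoc)
  qed
  let ?U = "\<integral>Y. u Y * G Y \<partial>lborel"
  have Upos: "0 < ?U"
    by (rule integral_lborel_pos[OF iu]) (simp add: u G_def)
  let ?RM = "\<integral>Y. (norm (M_SVS Y - \<theta>))\<^sup>2 * G Y \<partial>lborel"
  have RM: "integrable lborel (\<lambda>Y. (norm (M_SVS Y - \<theta>))\<^sup>2 * G Y)"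
    using risk[OF pM M_SVS_measurable[OF card]] by blast
  have "(\<integral>Y. (norm (d Y - \<theta>))\<^sup>2 * G Y \<partial>lborel)
      \<le> (\<integral>Y. (norm (M_SVS Y - \<theta>))\<^sup>2 * G Y + (1 + 2 * k) * (u Y * G Y) - 2 * (S Y * G Y) \<partial>lborel)"
    using risk[OF pd dm] RM iu iS by (intro integral_mono pw) auto
  also have "\<dots> = ?RM + (1 + 2 * k) * ?U - 2 * (\<integral>Y. D Y * G Y \<partial>lborel)"
    using RM iu iS by (simp add: SD)
  also have "\<dots> \<le> ?RM + (1 + 2 * k) * ?U - 2 * ((N - 2) * ?U)"
  proof -
    have "(\<integral>Y. (N - 2) * (u Y * G Y) \<partial>lborel) \<le> (\<integral>Y. D Y * G Y \<partial>lborel)"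
      using iu iD by (intro integral_mono Dlow) auto
    then show ?thesis using iu by simp
  qed
  \<comment> \<open>The coefficient of \<open>?U\<close> collects
    \<open>1 + 2 * k - 2 * (N - 2)\<close>; by \<open>Nk\<close> it is at most -7.\<close>
  also have "\<dots> = ?RM - (2 * (N - k) - 5) * ?U" by (simp add: algebra_simps)
  also have "\<dots> < ?RM" using Upos Nk by simp
  finally have "(\<integral>Y. (norm (d Y - \<theta>))\<^sup>2 * G Y \<partial>lborel) < ?RM" .
  moreover have "0 \<le> (\<integral>Y. (norm (d Y - \<theta>))\<^sup>2 * G Y \<partial>lborel)" by (simp add: G0)
  ultimately have "frob_risk d \<theta> < frob_risk M_SVS \<theta>"
    using risk[OF pd dm] risk[OF pM M_SVS_measurable[OF card]] gauss_norm_const_pos[where 'p = 'p and 'n = 'n]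
    by (simp add: ennreal_less_iff)
  then show ?thesis by (simp add: d_def u_def)
qed

text \<open>A type with \<open>n - p - 1\<close> elements, indexing the rows of the mixing matrix. The maximum only
  serves to make the representing set nonempty.\<close>

typedef ('n, 'p) codim = "{..<max 1 (CARD('n::finite) - CARD('p::finite) - 1)}"
  by (rule exI[of _ 0]) auto

lemma bij_betw_Rep_codim:
  "bij_betw Rep_codim (UNIV :: ('n::finite, 'p::finite) codim set) {..<max 1 (CARD('n) - CARD('p) - 1)}"
  using type_definition.Rep_range[OF type_definition_codim] Rep_codim_inject
  by (auto simp: bij_betw_def inj_def)

instance codim :: (finite, finite) finite
  by standard (use bij_betw_finite[OF bij_betw_Rep_codim] in auto)

lemma card_codim: "CARD(('n::finite, 'p::finite) codim) = max 1 (CARD('n) - CARD('p) - 1)"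
  using bij_betw_same_card[OF bij_betw_Rep_codim[where 'n = 'n and 'p = 'p]] by simp

theorem theorem1:
  assumes "CARD('n::finite) > CARD('p::finite) + 1"
    and "CARD('p) \<ge> 2"
  shows "\<exists>d :: real^'p^'n \<Rightarrow> real^'p^'n. d \<in> borel_measurable borel \<and>
           (\<forall>M. frob_risk d M \<le> frob_risk M_SVS M) \<and>
           (\<exists>M. frob_risk d M < frob_risk M_SVS M)"
proof -
  \<comment> \<open>The first assumption makes \<open>n - p - 1\<close> at least 1, so the maximum
    in \<open>card_codim\<close> is attained there and natural subtraction is not truncated.\<close>
  have card: "CARD('n) = CARD('p) + CARD(('n, 'p) codim) + 1"
    using assms(1) by (simp add: card_codim)
  note [measurable] = M_SVS_measurable[OF card]
  have "(\<lambda>Y::real^'p^'n. M_SVS Y - (1 / (1 + (norm Y)\<^sup>2)) *\<^sub>R Y) \<in> borel_measurable borel"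
    by measurable
  with risk_strict_improvement[OF card assms(2)] show ?thesis
    by (blast intro: less_imp_le)
qed

end
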